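(* For every $\varepsilon>0$ the following holds. Let $n,m$ be positive integers with $m\geq n+n^{1-\varepsilon/6}$, and let $M_{n,m}$ be an $n\times m$ random matrix whose entries are independent and uniformly distributed on $\{\pm1\}$. Then asymptotically almost surely (i.e. with probability tending to $1$ as $n\to\infty$) $$Res(M_{n,m})\geq (1-\varepsilon)\frac{m}{2}.$$
   Context: For an $n\times m$ matrix $M$ with entries in $\{\pm 1\}$, $Res(M)$ denotes the minimum number of entries of $M$ whose sign must be flipped in order to obtain a matrix of rank less than $n$ (rank over the reals). *)

theory Defs
  imports
    "HOL-Probability.Probability"
    "Jordan_Normal_Form.DL_Rank"
begin

definition flip_entries :: "(nat \<times> nat) set \<Rightarrow> real mat \<Rightarrow> real mat" where
  "flip_entries S M =
     mat (dim_row M) (dim_col M) (\<lambda>ij. if ij \<in> S then - (M $$ ij) else M $$ ij)"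

text \<open>
  The infimum is taken in \<^typ>\<open>enat\<close>, so it is a minimum whenever some set of flips makes
  the rank drop below the number of rows, and it is \<open>\<infinity>\<close> if there is no such set (as for a sign
  matrix with a single row). The first argument of \<^const>\<open>vec_space.rank\<close> is the dimension of
  the ambient space of the columns.
\<close>
definition Res :: "real mat \<Rightarrow> enat" where
  "Res M = Inf {enat (card S) | S. S \<subseteq> {..<dim_row M} \<times> {..<dim_col M} \<and>
                  vec_space.rank (dim_row M) (flip_entries S M) < dim_row M}"

definition random_sign_matrix :: "nat \<Rightarrow> nat \<Rightarrow> real mat pmf" where
  "random_sign_matrix n m =
     map_pmf (mat n m) (Pi_pmf ({..<n} \<times> {..<m}) 0 (\<lambda>_. pmf_of_set {-1, 1}))"

end

theory Submission
  imports Defs "HOL-Real_Asymp.Real_Asymp"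
begin

text \<open>
  A low-rank flip of the sign matrix yields a nonzero integer row vector, hence for every prime
  \<open>p\<close> a vector \<open>a\<close> modulo \<open>p\<close> that is not zero, annihilating all columns after the flips; \<open>p\<close> is
  chosen with \<open>log p\<close> about \<open>n\<close> to a power slightly larger than \<open>\<epsilon>/6\<close>.

  If \<open>a\<close> has small support, every column is annihilated with probability at most \<open>1/2\<close>, and a Chernoff
  bound on the number of columns that are not annihilated beats the number of such \<open>a\<close>.

  If \<open>a\<close> has large support, one takes the union over all sets of flips as well, since a flipped
  matrix has the same distribution. Let \<open>R(a)\<close> be the probability that \<open>a\<close> annihilates a column and
  \<open>H(a)\<close> the return probability modulo \<open>p\<close> of a lazy walk that is \<open>L\<^sup>2\<close> times slower. The level sets of
  the characteristic function grow linearly under addition (Cauchy--Davenport), which gives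
  \<open>R(a) \<le> 2/p + (2/L) H(a)\<close> with \<open>L\<close> about \<open>n\<close> to the power \<open>1/2 - \<epsilon>/5\<close>. Vectors with \<open>H(a) < L/p\<close> are
  killed by the \<open>m - n\<close> surplus columns. For the others, whenever the walk returns after a nontrivial
  excursion, some coordinate of \<open>a\<close> is determined by the rest; hence the sum of \<open>H(a)\<close> to the power \<open>n\<close> is
  at most \<open>n\<close> to the power \<open>(\<epsilon>/5 + o(1)) n\<close>, and the factor \<open>L\<close> to the power \<open>-m\<close> beats the number of flip sets, which
  is about \<open>n\<close> to the power \<open>(1 - \<epsilon>) m / 2\<close>.
\<close>

subsection \<open>Fourier analysis modulo \<open>p\<close>\<close>

definition residues_mod :: "nat \<Rightarrow> int set" where
  "residues_mod p = {0..<int p}"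

text \<open>The real part of the additive character modulo \<open>p\<close>. Cosines suffice because
  all step distributions below are symmetric, so their Fourier transforms are real.\<close>

definition coschar :: "nat \<Rightarrow> int \<Rightarrow> real" where
  "coschar p y = cos (2 * pi * of_int y / of_nat p)"

definition mean_mod :: "nat \<Rightarrow> (int \<Rightarrow> real) \<Rightarrow> real" where
  "mean_mod p f = (\<Sum>x\<in>residues_mod p. f x) / p"

text \<open>By Fourier inversion this is the probability that the sum of the \<open>a i\<close> with
  independent uniform signs vanishes modulo \<open>p\<close>; see
  \<open>card_annihilated\<close>.\<close>

definition cos_product_mean :: "nat \<Rightarrow> nat set \<Rightarrow> (nat \<Rightarrow> int) \<Rightarrow> real" where
  "cos_product_mean p B a = mean_mod p (\<lambda>x. \<Prod>i\<in>B. coschar p (x * a i))"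

text \<open>Return probability of the walk whose step \<open>i\<close> is zero with probability
  \<open>1 - \<tau>\<close> and \<open>a i\<close> or \<open>- a i\<close> with probability
  \<open>\<tau> / 2\<close> each; the factors are the characteristic functions of these
  steps.\<close>

definition lazy_return :: "nat \<Rightarrow> nat set \<Rightarrow> real \<Rightarrow> (nat \<Rightarrow> int) \<Rightarrow> real" where
  "lazy_return p B \<tau> a = mean_mod p (\<lambda>x. \<Prod>i\<in>B. 1 - \<tau> + \<tau> * coschar p (x * a i))"

lemma finite_residues_mod [simp]: "finite (residues_mod p)"
  by (simp add: residues_mod_def)

lemma card_residues_mod [simp]: "card (residues_mod p) = p"
  by (simp add: residues_mod_def)

lemma coschar_bounds [simp]: "coschar p y \<le> 1" "- 1 \<le> coschar p y"
  by (simp_all add: coschar_def)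

lemma coschar_mult: "coschar p y * coschar p z = (coschar p (y + z) + coschar p (y - z)) / 2"
  by (simp add: coschar_def cos_times_cos add_divide_distrib diff_divide_distrib distrib_left
      right_diff_distrib)

lemma coschar_0 [simp]: "coschar p 0 = 1"
  by (simp add: coschar_def)

lemma coschar_add_multiple: "coschar p (y + int p * k) = coschar p y"
proof (cases "p = 0")
  case False
  have "2 * pi * of_int (y + int p * k) / of_nat p = 2 * pi * of_int y / of_nat p + 2 * pi * of_int k"
    using False by (simp add: field_simps)
  then show ?thesis
    unfolding coschar_def by (simp only: cos_add cos_int_2pin sin_int_2pin mult_1_right mult_zero_right diff_zero)
qed simp

lemma coschar_cong: "y mod int p = z mod int p \<Longrightarrow> coschar p y = coschar p z"
  by (metis coschar_add_multiple mod_mult_div_eq mult.commute)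

text \<open>Orthogonality of characters: unless \<open>p\<close> divides \<open>y\<close>, the terms
  are real parts of the powers of a root of unity \<open>z \<noteq> 1\<close> with
  \<open>z ^ p = 1\<close>, whose geometric sum is zero.\<close>

lemma sum_coschar:
  assumes "p > 0"
  shows "(\<Sum>x\<in>residues_mod p. coschar p (x * y)) = (if int p dvd y then p else 0)"
proof (cases "int p dvd y")
  case True
  then have "coschar p (x * y) = 1" for x
    using coschar_cong[of "x * y" p 0] by simp
  then show ?thesis using True by simp
next
  case False
  define z where "z = cis (2 * pi * of_int y / of_nat p)"
  have zp: "z ^ p = 1"
  proof -
    have "real p * (2 * pi * of_int y / of_nat p) = 2 * pi * of_int y" using assms by simp
    then have "z ^ p = cis (2 * pi * of_int y)" unfolding z_def by (metis Complex.DeMoivre)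
    then show ?thesis by simp
  qed
  have "z \<noteq> 1"
  proof
    assume "z = 1"
    then have "cos (2 * pi * of_int y / of_nat p) = 1" by (simp add: z_def complex_eq_iff)
    then obtain k :: int where "2 * pi * of_int y / of_nat p = of_int k * 2 * pi"
      using cos_one_2pi_int by blast
    then have "real_of_int y = of_int k * of_nat p" using assms by (simp add: field_simps)
    then have "y = k * int p" by (metis of_int_eq_iff of_int_mult of_int_of_nat_eq)
    then show False using False by simp
  qed
  have "residues_mod p = int ` {..<p}"
    by (simp add: residues_mod_def lessThan_atLeast0 image_int_atLeastLessThan)
  then have "(\<Sum>x\<in>residues_mod p. coschar p (x * y)) = (\<Sum>k<p. coschar p (int k * y))"
    by (simp add: sum.reindex)
  also have "\<dots> = (\<Sum>k<p. Re (z ^ k))"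
    by (intro sum.cong) (auto simp: z_def Complex.DeMoivre coschar_def mult_ac)
  also have "\<dots> = Re (\<Sum>k<p. z ^ k)" by simp
  also have "(\<Sum>k<p. z ^ k) = 0" using geometric_sum[OF \<open>z \<noteq> 1\<close>, of p] zp by simp
  finally show ?thesis using False by simp
qed

lemma mean_mod_mono:
  "(\<And>x. x \<in> residues_mod p \<Longrightarrow> f x \<le> g x) \<Longrightarrow> mean_mod p f \<le> mean_mod p g"
  by (auto simp: mean_mod_def intro!: divide_right_mono sum_mono)

lemma mean_mod_add: "mean_mod p (\<lambda>x. f x + g x) = mean_mod p f + mean_mod p g"
  by (simp add: mean_mod_def sum.distrib add_divide_distrib)

lemma mean_mod_cmult: "mean_mod p (\<lambda>x. c * f x) = c * mean_mod p f"
  by (simp add: mean_mod_def sum_distrib_left)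

lemma mean_mod_const: "p > 0 \<Longrightarrow> mean_mod p (\<lambda>x. c) = c"
  by (simp add: mean_mod_def)

lemma mean_mod_coschar: "p > 0 \<Longrightarrow> mean_mod p (\<lambda>x. coschar p (x * y)) = (if int p dvd y then 1 else 0)"
  by (simp add: mean_mod_def sum_coschar)

text \<open>Each factor is the Fourier transform of a symmetric nonnegative measure.\<close>

lemma mean_mod_coschar_prod_nonneg:
  assumes "p > 0" "finite B" "\<And>i. i \<in> B \<Longrightarrow> u i \<ge> 0 \<and> w i \<ge> 0"
  shows "mean_mod p (\<lambda>x. coschar p (x * y) * (\<Prod>i\<in>B. u i + w i * coschar p (x * a i))) \<ge> 0"
  using assms(2,3)
proof (induction B arbitrary: y rule: finite_induct)
  case empty
  then show ?case using assms(1) by (simp add: mean_mod_coschar)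
next
  case (insert j B)
  define P where "P x = (\<Prod>i\<in>B. u i + w i * coschar p (x * a i))" for x
  \<comment> \<open>The product formula for cosines shifts \<open>y\<close> by \<open>a j\<close> in
    both directions, which is why \<open>y\<close> is arbitrary in the induction.\<close>
  have "coschar p (x * y) * (\<Prod>i\<in>insert j B. u i + w i * coschar p (x * a i)) =
     u j * (coschar p (x * y) * P x) + (w j / 2) * (coschar p (x * (y + a j)) * P x)
       + (w j / 2) * (coschar p (x * (y - a j)) * P x)" for x
  proof -
    have "coschar p (x * y) * (\<Prod>i\<in>insert j B. u i + w i * coschar p (x * a i))
       = u j * (coschar p (x * y) * P x) + w j * P x * (coschar p (x * y) * coschar p (x * a j))"
      using insert.hyps by (simp add: P_def algebra_simps)
    then show ?thesis unfolding coschar_mult by (simp add: algebra_simps)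
  qed
  then show ?case
    using insert.prems insert.IH unfolding P_def
    by (auto simp only: mean_mod_add mean_mod_cmult intro!: add_nonneg_nonneg mult_nonneg_nonneg) auto
qed

text \<open>A union bound: a returning walk either makes no step, with weight
  \<open>u ^ card B\<close>, or moves in some coordinate \<open>i\<close>, and then the others must
  bring it back.\<close>

lemma mean_mod_prod_le:
  assumes "p > 0" "finite B" "u \<ge> 0" "w \<ge> 0"
  shows "mean_mod p (\<lambda>x. \<Prod>i\<in>B. u + w * coschar p (x * a i)) \<le>
     u ^ card B + w * (\<Sum>i\<in>B. mean_mod p (\<lambda>x. coschar p (x * a i) *
        (\<Prod>l\<in>B - {i}. u + w * coschar p (x * a l))))"
  using assms(2)
proof (induction B rule: finite_induct)
  case empty
  then show ?case using assms(1) by (simp add: mean_mod_const)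
next
  case (insert j B)
  let ?c = "\<lambda>x i. coschar p (x * a i)"
  define P where "P C x = (\<Prod>i\<in>C. u + w * ?c x i)" for C x
  define E where "E C i = mean_mod p (\<lambda>x. ?c x i * P (C - {i}) x)" for C i
  have step: "u * E B i \<le> E (insert j B) i" if "i \<in> B" for i
  proof -
    have ij: "insert j B - {i} = insert j (B - {i})" using that insert.hyps by auto
    have "?c x i * P (insert j B - {i}) x = u * (?c x i * P (B - {i}) x)
        + w * (?c x i * (\<Prod>l\<in>insert j (B - {i}). (if l = j then 0 else u) + (if l = j then 1 else w) * ?c x l))" for x
    proof -
      have "(\<Prod>l\<in>B - {i}. (if l = j then 0 else u) + (if l = j then 1 else w) * ?c x l) = P (B - {i}) x"
        unfolding P_def using insert.hyps by (intro prod.cong) auto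
      then show ?thesis
        using insert.hyps unfolding ij P_def by (simp add: algebra_simps)
    qed
    then have "E (insert j B) i = u * E B i + w * mean_mod p (\<lambda>x. ?c x i *
        (\<Prod>l\<in>insert j (B - {i}). (if l = j then 0 else u) + (if l = j then 1 else w) * ?c x l))"
      unfolding E_def by (simp only: mean_mod_add mean_mod_cmult)
    moreover have "mean_mod p (\<lambda>x. coschar p (x * a i) *
        (\<Prod>l\<in>insert j (B - {i}). (if l = j then 0 else u) + (if l = j then 1 else w) * ?c x l)) \<ge> 0"
      using assms insert.hyps by (intro mean_mod_coschar_prod_nonneg) auto
    ultimately show ?thesis using assms by simp
  qed
  have "mean_mod p (P (insert j B)) = u * mean_mod p (P B) + w * E (insert j B) j"
  proof -
    have "P (insert j B) = (\<lambda>x. u * P B x + w * (?c x j * P (insert j B - {j}) x))"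
      using insert.hyps by (auto simp: P_def algebra_simps)
    then show ?thesis by (simp only: mean_mod_add mean_mod_cmult E_def)
  qed
  also have "\<dots> \<le> u * (u ^ card B + w * (\<Sum>i\<in>B. E B i)) + w * E (insert j B) j"
    using insert.IH assms by (simp add: P_def[abs_def] E_def mult_left_mono)
  also have "\<dots> = u ^ card (insert j B) + w * ((\<Sum>i\<in>B. u * E B i) + E (insert j B) j)"
    using insert.hyps by (simp add: algebra_simps sum_distrib_left)
  also have "\<dots> \<le> u ^ card (insert j B) + w * ((\<Sum>i\<in>B. E (insert j B) i) + E (insert j B) j)"
    using assms by (intro add_mono mult_left_mono sum_mono step) auto
  finally show ?case
    using insert.hyps by (simp add: P_def[abs_def] E_def add.commute)
qed

subsection \<open>Lazy walks and the counting of structured vectors\<close>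

lemma lazy_factor_bounds:
  assumes "0 \<le> \<tau>" "\<tau> \<le> 1 / 2"
  shows "0 \<le> 1 - \<tau> + \<tau> * coschar p y" "1 - \<tau> + \<tau> * coschar p y \<le> 1"
proof -
  have "\<tau> * (-1) \<le> \<tau> * coschar p y" using assms by (intro mult_left_mono) auto
  then show "0 \<le> 1 - \<tau> + \<tau> * coschar p y" using assms by linarith
  have "\<tau> * coschar p y \<le> \<tau> * 1" using assms by (intro mult_left_mono) auto
  then show "1 - \<tau> + \<tau> * coschar p y \<le> 1" by simp
qed

lemma lazy_return_nonneg:
  assumes "0 \<le> \<tau>" "\<tau> \<le> 1 / 2"
  shows "0 \<le> lazy_return p B \<tau> a"
  unfolding lazy_return_def mean_mod_def
  by (intro divide_nonneg_nonneg sum_nonneg prod_nonneg) (auto intro: lazy_factor_bounds[OF assms])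

lemma lazy_return_le_1:
  assumes "0 \<le> \<tau>" "\<tau> \<le> 1 / 2" "p > 0"
  shows "lazy_return p B \<tau> a \<le> 1"
proof -
  have "lazy_return p B \<tau> a \<le> mean_mod p (\<lambda>x. 1)"
    unfolding lazy_return_def
    by (intro mean_mod_mono prod_le_1) (use lazy_factor_bounds[OF assms(1,2)] in auto)
  then show ?thesis using assms by (simp add: mean_mod_const)
qed

lemma lazy_return_mono_time:
  assumes "0 \<le> \<sigma>" "\<sigma> \<le> \<tau>" "\<tau> \<le> 1 / 2"
  shows "lazy_return p B \<tau> a \<le> lazy_return p B \<sigma> a"
  unfolding lazy_return_def
proof (intro mean_mod_mono prod_mono conjI)
  fix x i
  show "0 \<le> 1 - \<tau> + \<tau> * coschar p (x * a i)" using assms by (intro lazy_factor_bounds) auto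
  have "\<sigma> * (1 - coschar p (x * a i)) \<le> \<tau> * (1 - coschar p (x * a i))"
    using assms by (intro mult_right_mono) auto
  then show "1 - \<tau> + \<tau> * coschar p (x * a i) \<le> 1 - \<sigma> + \<sigma> * coschar p (x * a i)"
    by (simp add: algebra_simps)
qed

lemma lazy_return_remove:
  assumes "0 \<le> \<tau>" "\<tau> \<le> 1 / 2" "finite B"
  shows "lazy_return p B \<tau> a \<le> lazy_return p (B - {i}) \<tau> a"
proof (cases "i \<in> B")
  case True
  show ?thesis unfolding lazy_return_def
  proof (intro mean_mod_mono)
    fix x
    let ?f = "\<lambda>i. 1 - \<tau> + \<tau> * coschar p (x * a i)"
    have "prod ?f B = ?f i * prod ?f (B - {i})" using True assms by (simp add: prod.remove)
    also have "\<dots> \<le> 1 * prod ?f (B - {i})"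
      by (intro mult_right_mono prod_nonneg) (use lazy_factor_bounds[OF assms(1,2)] in auto)
    finally show "prod ?f B \<le> prod ?f (B - {i})" by simp
  qed
qed simp

lemma lazy_return_cong: "(\<And>i. i \<in> B \<Longrightarrow> a i = b i) \<Longrightarrow> lazy_return p B \<tau> a = lazy_return p B \<tau> b"
  unfolding lazy_return_def by simp

section \<open>Counting residue vectors\<close>

definition vecs_mod :: "nat \<Rightarrow> nat set \<Rightarrow> (nat \<Rightarrow> int) set" where
  "vecs_mod p B = B \<rightarrow>\<^sub>E residues_mod p"

lemma finite_vecs_mod [simp]: "finite B \<Longrightarrow> finite (vecs_mod p B)"
  by (simp add: vecs_mod_def finite_PiE)

lemma card_vecs_mod: "finite B \<Longrightarrow> card (vecs_mod p B) = p ^ card B"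
  by (simp add: vecs_mod_def card_PiE)

lemma sum_vecs_mod_remove:
  fixes f :: "(nat \<Rightarrow> int) \<Rightarrow> real"
  assumes "i \<in> B"
  shows "(\<Sum>a\<in>vecs_mod p B. f a) = (\<Sum>a\<in>vecs_mod p (B - {i}). \<Sum>y\<in>residues_mod p. f (a(i := y)))"
proof -
  have B: "B = insert i (B - {i})" using assms by auto
  have eq: "vecs_mod p B = (\<lambda>(y, g). g(i := y)) ` (residues_mod p \<times> vecs_mod p (B - {i}))"
    unfolding vecs_mod_def by (subst B, subst PiE_insert_eq) simp
  have inj: "inj_on (\<lambda>(y, g). g(i := y)) (residues_mod p \<times> vecs_mod p (B - {i}))"
    unfolding vecs_mod_def using inj_combinator[of i "B - {i}" "\<lambda>_. residues_mod p"] by simp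
  have "(\<Sum>a\<in>vecs_mod p B. f a) = (\<Sum>(y, a)\<in>residues_mod p \<times> vecs_mod p (B - {i}). f (a(i := y)))"
    unfolding eq by (subst sum.reindex[OF inj]) (auto simp: case_prod_unfold intro!: sum.cong)
  also have "\<dots> = (\<Sum>y\<in>residues_mod p. \<Sum>a\<in>vecs_mod p (B - {i}). f (a(i := y)))"
    by (simp add: sum.cartesian_product)
  finally show ?thesis by (subst sum.swap)
qed

text \<open>Summing over \<open>y\<close> first kills every frequency except \<open>x = 0\<close>.
  With \<open>G 0 = 1\<close> it says that, the other coordinates being fixed, the probabilities
  that a candidate value \<open>y\<close> of the removed coordinate closes the walk add up to
  one.\<close>

lemma sum_mean_mod_coschar:
  assumes "p > 0"
  shows "(\<Sum>y\<in>residues_mod p. mean_mod p (\<lambda>x. coschar p (x * y) * G x)) = G 0"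
proof -
  have "(\<Sum>y\<in>residues_mod p. mean_mod p (\<lambda>x. coschar p (x * y) * G x))
     = (\<Sum>x\<in>residues_mod p. \<Sum>y\<in>residues_mod p. coschar p (x * y) * G x) / p"
    unfolding mean_mod_def by (subst sum.swap) (simp add: sum_divide_distrib)
  also have "(\<Sum>x\<in>residues_mod p. \<Sum>y\<in>residues_mod p. coschar p (x * y) * G x)
      = (\<Sum>x\<in>residues_mod p. G x * (\<Sum>y\<in>residues_mod p. coschar p (y * x)))"
    by (simp add: sum_distrib_left mult.commute)
  also have "\<dots> = (\<Sum>x\<in>residues_mod p. if x = 0 then G 0 * p else 0)"
  proof (intro sum.cong refl)
    fix x assume "x \<in> residues_mod p"
    then have "int p dvd x \<longleftrightarrow> x = 0" by (auto simp: residues_mod_def zdvd_not_zless dest: zdvd_imp_le)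
    then show "G x * (\<Sum>y\<in>residues_mod p. coschar p (y * x)) = (if x = 0 then G 0 * p else 0)"
      using assms by (simp add: sum_coschar)
  qed
  also have "\<dots> = G 0 * p" using assms by (simp add: residues_mod_def)
  finally show ?thesis using assms by simp
qed

text \<open>The time is slowed to \<open>\<tau> s / |B|\<close> in each step, so that the expected number of steps of the
  walk, which is the loss per coordinate, stays \<open>\<tau> s\<close>.\<close>

lemma sum_lazy_return_power_le:
  assumes p: "p > 0" and \<tau>: "0 < \<tau>" "\<tau> \<le> 1 / 2" and \<theta>: "2 * exp (- (\<tau> * real s)) \<le> \<theta>"
    and B: "finite B" "s \<le> card B"
  shows "(\<Sum>a\<in>{a \<in> vecs_mod p B. \<theta> \<le> lazy_return p B \<tau> a}. lazy_return p B \<tau> a ^ (card B - s))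
     \<le> (2 * (\<tau> * real s)) ^ (card B - s) * real p ^ s"
  using B
proof (induction "card B - s" arbitrary: B)
  case 0
  then have s: "card B = s" by simp
  have "card {a \<in> vecs_mod p B. \<theta> \<le> lazy_return p B \<tau> a} \<le> card (vecs_mod p B)"
    using 0 by (intro card_mono) auto
  then have "real (card {a \<in> vecs_mod p B. \<theta> \<le> lazy_return p B \<tau> a}) \<le> real (p ^ s)"
    using 0 s by (simp add: card_vecs_mod del: of_nat_power)
  then show ?case using s by simp
next
  case (Suc d)
  define j where "j = card B"
  have j: "j > s" "j - s = Suc d" "j - Suc 0 - s = d" using Suc by (auto simp: j_def)
  define \<sigma> where "\<sigma> = \<tau> * real s / real j"
  have \<sigma>: "0 \<le> \<sigma>" "\<sigma> \<le> \<tau>" "\<sigma> \<le> 1 / 2" "\<sigma> * real j = \<tau> * real s"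
  proof -
    have "\<tau> * real s \<le> \<tau> * real j" using \<tau> j by (intro mult_left_mono) auto
    then show "\<sigma> \<le> \<tau>" using j by (simp add: \<sigma>_def field_simps)
    then show "\<sigma> \<le> 1 / 2" using \<tau> by simp
  qed (use \<tau> j in \<open>auto simp: \<sigma>_def\<close>)
  define H where "H C a = lazy_return p C \<tau> a" for C a
  define G where "G i a x = (\<Prod>l\<in>B - {i}. 1 - \<sigma> + \<sigma> * coschar p (x * a l))" for i a x
  define E where "E i a y = mean_mod p (\<lambda>x. coschar p (x * y) * G i a x)" for i a y
  have E0: "E i a y \<ge> 0" for i a y
    unfolding E_def G_def using p \<sigma> Suc by (intro mean_mod_coschar_prod_nonneg) auto
  have H0: "H C a \<ge> 0" for C a unfolding H_def using \<tau> by (intro lazy_return_nonneg) auto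
  have Hrem: "H B a \<le> H (B - {i}) a" for a i
    unfolding H_def using \<tau> Suc by (intro lazy_return_remove) auto
  \<comment> \<open>The slowed walk makes no step with probability
    \<open>(1 - \<sigma>) ^ j\<close>, at most half of the threshold \<open>\<theta>\<close>;
    absorbing this half into the left-hand side produces the factor 2.\<close>
  have key: "H B a \<le> 2 * \<sigma> * (\<Sum>i\<in>B. E i a (a i))" if "\<theta> \<le> H B a" for a
  proof -
    have "(1 - \<sigma>) ^ j \<le> exp (- \<sigma>) ^ j"
      using \<sigma> exp_ge_add_one_self[of "- \<sigma>"] by (intro power_mono) auto
    also have "\<dots> = exp (- (\<tau> * real s))"
      by (simp add: \<sigma>(4)[symmetric] exp_of_nat_mult[symmetric] mult.commute)
    finally have 1: "(1 - \<sigma>) ^ j \<le> \<theta> / 2" using \<theta> by linarith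
    have "H B a \<le> lazy_return p B \<sigma> a"
      unfolding H_def using \<sigma> \<tau> by (intro lazy_return_mono_time) auto
    moreover have "lazy_return p B \<sigma> a \<le> (1 - \<sigma>) ^ j + \<sigma> * (\<Sum>i\<in>B. E i a (a i))"
      unfolding lazy_return_def E_def G_def j_def
      using p Suc \<sigma> by (intro mean_mod_prod_le) auto
    ultimately show ?thesis using 1 that by linarith
  qed
  \<comment> \<open>Neither the threshold nor the power depends on \<open>a i\<close>, so this
    coordinate is summed out with total mass one and the induction hypothesis for
    \<open>B - {i}\<close> applies.\<close>
  have step: "(\<Sum>a\<in>vecs_mod p B. if \<theta> \<le> H (B - {i}) a then E i a (a i) * H (B - {i}) a ^ d else 0)
     \<le> (2 * (\<tau> * real s)) ^ d * real p ^ s" if i: "i \<in> B" for i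
  proof -
    have "(\<Sum>a\<in>vecs_mod p B. if \<theta> \<le> H (B - {i}) a then E i a (a i) * H (B - {i}) a ^ d else 0)
      = (\<Sum>a\<in>vecs_mod p (B - {i}). \<Sum>y\<in>residues_mod p.
           if \<theta> \<le> H (B - {i}) a then E i a y * H (B - {i}) a ^ d else 0)"
    proof -
      have "H (B - {i}) (a(i := y)) = H (B - {i}) a" for a y
        unfolding H_def by (rule lazy_return_cong) auto
      moreover have "E i (a(i := y)) z = E i a z" for a y z
      proof -
        have "G i (a(i := y)) x = G i a x" for x unfolding G_def by (intro prod.cong) auto
        then show ?thesis by (simp add: E_def)
      qed
      ultimately show ?thesis
        using i by (subst sum_vecs_mod_remove[of i]) (auto intro!: sum.cong)
    qed
    also have "\<dots> = (\<Sum>a\<in>vecs_mod p (B - {i}).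
         if \<theta> \<le> H (B - {i}) a then (\<Sum>y\<in>residues_mod p. E i a y) * H (B - {i}) a ^ d else 0)"
      by (intro sum.cong) (auto simp: sum_distrib_right)
    also have "\<dots> = (\<Sum>a\<in>vecs_mod p (B - {i}). if \<theta> \<le> H (B - {i}) a then H (B - {i}) a ^ d else 0)"
    proof -
      have "(\<Sum>y\<in>residues_mod p. E i a y) = 1" for a
        unfolding E_def using p by (simp add: sum_mean_mod_coschar G_def)
      then show ?thesis by (intro sum.cong) auto
    qed
    also have "\<dots> = (\<Sum>a\<in>{a \<in> vecs_mod p (B - {i}). \<theta> \<le> H (B - {i}) a}. H (B - {i}) a ^ d)"
      using Suc.prems by (simp add: sum.If_cases Int_def)
    also have "\<dots> \<le> (2 * (\<tau> * real s)) ^ d * real p ^ s"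
      using Suc.hyps(1)[of "B - {i}"] Suc.prems i j by (simp add: H_def j_def)
    finally show ?thesis .
  qed
  \<comment> \<open>One of the \<open>Suc d\<close> factors is expanded by \<open>key\<close>; in
    the other factors and in the threshold coordinate \<open>i\<close> is dropped, which can only
    increase the return probability.\<close>
  have "(\<Sum>a\<in>{a \<in> vecs_mod p B. \<theta> \<le> H B a}. H B a ^ Suc d)
     \<le> (\<Sum>a\<in>{a \<in> vecs_mod p B. \<theta> \<le> H B a}. 2 * \<sigma> *
          (\<Sum>i\<in>B. if \<theta> \<le> H (B - {i}) a then E i a (a i) * H (B - {i}) a ^ d else 0))"
  proof (intro sum_mono)
    fix a assume "a \<in> {a \<in> vecs_mod p B. \<theta> \<le> H B a}"
    then have a: "\<theta> \<le> H B a" by simp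
    have "H B a ^ Suc d \<le> 2 * \<sigma> * (\<Sum>i\<in>B. E i a (a i)) * H B a ^ d"
      using key[OF a] H0 by (simp add: mult_right_mono)
    also have "\<dots> = 2 * \<sigma> * (\<Sum>i\<in>B. E i a (a i) * H B a ^ d)"
      by (simp add: sum_distrib_right sum_distrib_left mult_ac)
    also have "\<dots> \<le> 2 * \<sigma> * (\<Sum>i\<in>B. E i a (a i) * H (B - {i}) a ^ d)"
      using \<sigma> by (intro mult_left_mono sum_mono power_mono Hrem E0 H0) auto
    finally show "H B a ^ Suc d \<le> 2 * \<sigma> *
        (\<Sum>i\<in>B. if \<theta> \<le> H (B - {i}) a then E i a (a i) * H (B - {i}) a ^ d else 0)"
      using order_trans[OF a Hrem] by simp
  qed
  also have "\<dots> \<le> (\<Sum>a\<in>vecs_mod p B. 2 * \<sigma> *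
          (\<Sum>i\<in>B. if \<theta> \<le> H (B - {i}) a then E i a (a i) * H (B - {i}) a ^ d else 0))"
    using Suc.prems \<sigma> E0 H0 by (intro sum_mono2) (auto intro!: mult_nonneg_nonneg sum_nonneg)
  also have "\<dots> = 2 * \<sigma> * (\<Sum>i\<in>B. \<Sum>a\<in>vecs_mod p B.
          if \<theta> \<le> H (B - {i}) a then E i a (a i) * H (B - {i}) a ^ d else 0)"
    by (subst sum.swap) (simp add: sum_distrib_left)
  also have "\<dots> \<le> 2 * \<sigma> * (\<Sum>i\<in>B. (2 * (\<tau> * real s)) ^ d * real p ^ s)"
    using \<sigma> by (intro mult_left_mono sum_mono step) auto
  \<comment> \<open>The sum over \<open>j\<close> coordinates turns \<open>\<sigma>\<close> into
    \<open>\<sigma> * j = \<tau> * s\<close>, the same loss in every round.\<close>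
  also have "\<dots> = 2 * (\<sigma> * real j) * (2 * (\<tau> * real s)) ^ d * real p ^ s"
    by (simp add: j_def)
  also have "\<dots> = (2 * (\<tau> * real s)) ^ Suc d * real p ^ s"
    unfolding \<sigma>(4) by simp
  finally show ?case using j by (simp add: H_def j_def)
qed

subsection \<open>The Cauchy--Davenport theorem\<close>

definition sumset_mod :: "nat \<Rightarrow> int set \<Rightarrow> int set \<Rightarrow> int set" where
  "sumset_mod p X Y = {(x + y) mod int p | x y. x \<in> X \<and> y \<in> Y}"

text \<open>As \<open>d\<close> is invertible modulo \<open>p\<close>, the points
  \<open>x + t d\<close> with \<open>t < p\<close> are pairwise distinct, and all of them lie in
  \<open>X\<close>.\<close>

lemma translation_invariant_mod_prime:
  assumes p: "prime p" and X: "X \<subseteq> residues_mod p" "X \<noteq> {}" and d: "\<not> int p dvd d"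
    and inv: "\<And>x. x \<in> X \<Longrightarrow> (x + d) mod int p \<in> X"
  shows "X = residues_mod p"
proof -
  obtain x where x: "x \<in> X" using X by auto
  have p0: "p > 0" using p prime_gt_0_nat by blast
  have mem: "(x + int t * d) mod int p \<in> X" for t
  proof (induction t)
    case 0
    then show ?case using x X by (auto simp: residues_mod_def)
  next
    case (Suc t)
    have "((x + int t * d) mod int p + d) mod int p \<in> X" using inv[OF Suc] .
    then have "(x + int t * d + d) mod int p \<in> X" by (simp only: mod_add_left_eq)
    then show ?case by (simp add: algebra_simps)
  qed
  have inj: "inj_on (\<lambda>t. (x + int t * d) mod int p) {..<p}"
  proof (rule inj_onI)
    fix t u assume tu: "t \<in> {..<p}" "u \<in> {..<p}"
      and eq: "(x + int t * d) mod int p = (x + int u * d) mod int p"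
    have "int p dvd (int t - int u) * d"
      using eq by (simp add: mod_eq_dvd_iff algebra_simps)
    then have "int p dvd int t - int u"
      using p d by (simp add: prime_dvd_mult_iff)
    moreover have "\<bar>int t - int u\<bar> < int p" using tu by auto
    ultimately have "int t - int u = 0" using dvd_imp_le_int[of "int t - int u" "int p"] by linarith
    then show "t = u" by simp
  qed
  have "p = card ((\<lambda>t. (x + int t * d) mod int p) ` {..<p})" by (simp add: card_image[OF inj])
  also have "\<dots> \<le> card X"
    using mem finite_subset[OF X(1)] by (intro card_mono) auto
  finally show ?thesis using X card_subset_eq[of "residues_mod p" X] card_mono[of "residues_mod p" X]
    by auto
qed

text \<open>Induction on \<open>card Y\<close> by the Dyson transform: elements of \<open>Y\<close>
  whose shift misses \<open>X\<close> are moved, shifted, into \<open>X\<close>. This keeps the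
  total size and does not enlarge the sumset.\<close>

theorem Cauchy_Davenport:
  assumes p: "prime p" and "X \<subseteq> residues_mod p" "X \<noteq> {}" "Y \<subseteq> residues_mod p" "Y \<noteq> {}"
  shows "min p (card X + card Y - 1) \<le> card (sumset_mod p X Y)"
  using assms(2-)
proof (induction "card Y" arbitrary: X Y rule: less_induct)
  case less
  note X = less.prems(1,2) and Y = less.prems(3,4)
  have p0: "p > 0" using p prime_gt_0_nat by blast
  have fin: "finite X" "finite Y" using X Y finite_subset[OF _ finite_residues_mod] by auto
  have md: "z mod int p = z" if "z \<in> X \<union> Y" for z
    using that X Y by (auto simp: residues_mod_def)
  have finS: "finite (sumset_mod p V W)" for V W
    by (rule finite_subset[of _ "residues_mod p"]) (use p0 in \<open>auto simp: sumset_mod_def residues_mod_def\<close>)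
  show ?case
  proof (cases "\<exists>x\<in>X. \<exists>y\<in>Y. \<exists>z\<in>Y. (z + (x - y)) mod int p \<notin> X")
    case True
    then obtain x y z where xyz: "x \<in> X" "y \<in> Y" "z \<in> Y" "(z + (x - y)) mod int p \<notin> X" by auto
    \<comment> \<open>The shift by \<open>e\<close> sends \<open>y\<close> to \<open>x\<close> but
      \<open>z\<close> outside \<open>X\<close>, so \<open>Y1\<close> contains \<open>y\<close> and
      not \<open>z\<close>: it is nonempty and strictly smaller than \<open>Y\<close>.\<close>
    define e where "e = x - y"
    define h where "h u = (u + e) mod int p" for u
    define Y1 where "Y1 = {u \<in> Y. h u \<in> X}"
    define X1 where "X1 = X \<union> h ` (Y - Y1)"
    have "inj_on h Y"
    proof (rule inj_onI)
      fix u v assume "u \<in> Y" "v \<in> Y" "h u = h v"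
      then have "u mod int p = v mod int p" by (simp add: h_def mod_eq_dvd_iff)
      then show "u = v" using md \<open>u \<in> Y\<close> \<open>v \<in> Y\<close> by simp
    qed
    have "y \<in> Y1" using xyz md by (auto simp: Y1_def h_def e_def)
    have "z \<notin> Y1" using xyz by (auto simp: Y1_def h_def e_def)
    have Y1: "Y1 \<subset> Y" "Y1 \<noteq> {}" using \<open>y \<in> Y1\<close> \<open>z \<notin> Y1\<close> xyz by (auto simp: Y1_def)
    have c1: "card X1 + card Y1 = card X + card Y"
    proof -
      have "card X1 = card X + card (h ` (Y - Y1))"
        unfolding X1_def using fin by (intro card_Un_disjoint) (auto simp: Y1_def)
      also have "card (h ` (Y - Y1)) = card (Y - Y1)"
        using \<open>inj_on h Y\<close> by (intro card_image) (auto intro: inj_on_subset)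
      also have "card (Y - Y1) = card Y - card Y1"
        using Y1 fin by (intro card_Diff_subset) (auto intro: finite_subset)
      finally show ?thesis using card_mono[OF fin(2), of Y1] Y1 by auto
    qed
    have "X1 \<subseteq> residues_mod p" using X p0 by (auto simp: X1_def h_def residues_mod_def)
    then have "min p (card X1 + card Y1 - 1) \<le> card (sumset_mod p X1 Y1)"
      using less.hyps[of Y1 X1] Y1 X Y fin psubset_card_mono[OF fin(2), of Y1] by (auto simp: X1_def)
    also have "\<dots> \<le> card (sumset_mod p X Y)"
    proof (intro card_mono finS subsetI)
      fix w assume "w \<in> sumset_mod p X1 Y1"
      then obtain a b where w: "w = (a + b) mod int p" "a \<in> X1" "b \<in> Y1"
        by (auto simp: sumset_mod_def)
      show "w \<in> sumset_mod p X Y"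
      proof (cases "a \<in> X")
        case True
        then show ?thesis using w by (auto simp: sumset_mod_def Y1_def)
      next
        case False
        then obtain c where c: "c \<in> Y" "a = h c" using w by (auto simp: X1_def)
        \<comment> \<open>The shift is passed from \<open>c\<close> to \<open>b\<close>, since
          \<open>(c + e) + b = (b + e) + c\<close>.\<close>
        have "w = (h b + c) mod int p"
          unfolding w c h_def mod_add_left_eq by (simp only: ac_simps)
        moreover have "h b \<in> X" using w by (simp add: Y1_def)
        ultimately show ?thesis using c by (auto simp: sumset_mod_def)
      qed
    qed
    finally show ?thesis using c1 by simp
  next
    \<comment> \<open>Now \<open>X\<close> is invariant under all differences of elements of
      \<open>Y\<close>, so \<open>Y\<close> is a singleton or \<open>X\<close> is
      everything.\<close>
    case False
    show ?thesis
    proof (cases "card Y = 1")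
      case True
      then obtain y where y: "Y = {y}" by (auto simp: card_1_singleton_iff)
      have "inj_on (\<lambda>x. (x + y) mod int p) X"
      proof (rule inj_onI)
        fix u v assume "u \<in> X" "v \<in> X" "(u + y) mod int p = (v + y) mod int p"
        then have "u mod int p = v mod int p" by (simp add: mod_eq_dvd_iff)
        then show "u = v" using md \<open>u \<in> X\<close> \<open>v \<in> X\<close> by simp
      qed
      moreover have "sumset_mod p X Y = (\<lambda>x. (x + y) mod int p) ` X" using y by (auto simp: sumset_mod_def)
      ultimately show ?thesis using True by (simp add: card_image)
    next
      case False': False
      obtain y where y: "y \<in> Y" using Y by auto
      have "Y \<noteq> {y}" using False' by auto
      then obtain z where z: "z \<in> Y" "z \<noteq> y" using y by auto
      have "X = residues_mod p"
      proof (rule translation_invariant_mod_prime[OF p X])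
        show "\<not> int p dvd z - y"
          using md[of z] md[of y] y z by (auto simp: mod_eq_dvd_iff[symmetric])
        show "(x + (z - y)) mod int p \<in> X" if "x \<in> X" for x
        proof -
          have "(z + (x - y)) mod int p \<in> X" using False that y z by blast
          then show ?thesis by (simp add: algebra_simps)
        qed
      qed
      have "X = sumset_mod p X {y}" if "X = residues_mod p"
      proof
        show "X \<subseteq> sumset_mod p X {y}"
        proof
          fix x assume "x \<in> X"
          then have "((x - y) mod int p + y) mod int p = x" using md[of x] by (simp add: mod_add_left_eq)
          moreover have "(x - y) mod int p \<in> X" using that p0 by (simp add: residues_mod_def)
          ultimately show "x \<in> sumset_mod p X {y}" unfolding sumset_mod_def
            by (smt (verit) mem_Collect_eq singletonI)
        qed
      qed (use p0 that in \<open>auto simp: sumset_mod_def residues_mod_def\<close>)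
      then have "X \<subseteq> sumset_mod p X Y" using \<open>X = residues_mod p\<close> y
        unfolding sumset_mod_def by blast
      then show ?thesis using card_mono[OF finS] \<open>X = residues_mod p\<close>
        by (metis card_residues_mod min.coboundedI1)
    qed
  qed
qed

subsection \<open>Halasz-type inequality\<close>

text \<open>Twice the sum of the squared sines of the half angles. Small energy at the frequency
  \<open>x\<close> means a large Fourier coefficient of the lazy walk, so the level sets below are
  its large spectra.\<close>

definition energy :: "nat \<Rightarrow> nat set \<Rightarrow> (nat \<Rightarrow> int) \<Rightarrow> int \<Rightarrow> real" where
  "energy p B a x = (\<Sum>i\<in>B. 1 - coschar p (x * a i))"

definition level_set :: "nat \<Rightarrow> nat set \<Rightarrow> (nat \<Rightarrow> int) \<Rightarrow> real \<Rightarrow> int set" where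
  "level_set p B a l = {x \<in> residues_mod p. energy p B a x \<le> l}"

lemma level_set_subset: "level_set p B a l \<subseteq> residues_mod p"
  by (auto simp: level_set_def)

lemma finite_level_set [simp]: "finite (level_set p B a l)"
  by (rule finite_subset[OF level_set_subset]) simp

lemma energy_nonneg [simp]: "0 \<le> energy p B a x"
  by (simp add: energy_def sum_nonneg)

lemma energy_mod: "energy p B a (x mod int p) = energy p B a x"
  unfolding energy_def by (intro sum.cong refl arg_cong2[where f = minus] coschar_cong) (simp add: mod_mult_left_eq)

text \<open>By \<open>1 - cos (2 t) = 2 (sin t)^2\<close> the root of the energy is the Euclidean
  norm of a vector of absolute sines; the absolute sine is subadditive, and the triangle inequality
  finishes.\<close>

lemma sqrt_energy_add:
  "sqrt (energy p B a (x + y)) \<le> sqrt (energy p B a x) + sqrt (energy p B a y)"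
proof -
  define S where "S x i = sqrt 2 * \<bar>sin (pi * of_int (x * a i) / p)\<bar>" for x i
  have eq: "sqrt (energy p B a x) = L2_set (S x) B" for x
  proof -
    have "1 - coschar p (x * a i) = (S x i)\<^sup>2" for i
    proof -
      have "2 * pi * of_int (x * a i) / p = 2 * (pi * of_int (x * a i) / p)" by simp
      then have "coschar p (x * a i) = 1 - 2 * (sin (pi * of_int (x * a i) / p))\<^sup>2"
        unfolding coschar_def by (simp only: cos_double_sin)
      then show ?thesis by (simp add: S_def power_mult_distrib)
    qed
    then show ?thesis by (simp add: energy_def L2_set_def)
  qed
  have "L2_set (S (x + y)) B \<le> L2_set (\<lambda>i. S x i + S y i) B"
  proof (rule L2_set_mono)
    fix i
    let ?s = "pi * of_int (x * a i) / p" and ?t = "pi * of_int (y * a i) / p"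
    have "pi * of_int ((x + y) * a i) / p = ?s + ?t"
      by (simp add: distrib_right distrib_left add_divide_distrib)
    moreover have "\<bar>sin (?s + ?t)\<bar> \<le> \<bar>sin ?s\<bar> + \<bar>sin ?t\<bar>"
    proof -
      have "\<bar>sin (?s + ?t)\<bar> \<le> \<bar>sin ?s\<bar> * \<bar>cos ?t\<bar> + \<bar>cos ?s\<bar> * \<bar>sin ?t\<bar>"
        unfolding sin_add by (metis abs_mult abs_triangle_ineq)
      also have "\<dots> \<le> \<bar>sin ?s\<bar> * 1 + 1 * \<bar>sin ?t\<bar>"
        by (intro add_mono mult_mono) auto
      finally show ?thesis by simp
    qed
    ultimately show "S (x + y) i \<le> S x i + S y i"
      unfolding S_def by (simp flip: distrib_left)
  qed (simp add: S_def)
  also have "\<dots> \<le> L2_set (S x) B + L2_set (S y) B" by (rule L2_set_triangle_ineq)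
  finally show ?thesis by (simp add: eq)
qed

text \<open>By \<open>sqrt_energy_add\<close>, sums of \<open>Suc j\<close> elements of the level
  set for \<open>l\<close> lie in the level set for \<open>(Suc j)^2 l\<close>; Cauchy--Davenport
  bounds the iterated sumset from below.\<close>

lemma card_level_set_growth:
  fixes l :: real
  assumes p: "prime p" and l: "l \<ge> 0"
  shows "min p (Suc j * (card (level_set p B a l) - 1) + 1)
    \<le> card (level_set p B a ((real (Suc j))\<^sup>2 * l))"
proof -
  have p0: "p > 0" using p prime_gt_0_nat by blast
  define T where "T j = level_set p B a ((real (Suc j))\<^sup>2 * l)" for j
  have T0: "0 \<in> T j" for j
    using p0 l by (auto simp: T_def level_set_def residues_mod_def energy_def)
  have T_res: "T j \<subseteq> residues_mod p" for j by (simp add: T_def level_set_subset)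
  have finT: "finite (T j)" for j by (simp add: T_def)
  have cT: "card (T j) > 0" for j using T0[of j] finT[of j] by (auto simp: card_gt_0_iff)
  have "min p (Suc j * (card (T 0) - 1) + 1) \<le> card (T j)"
  proof (induction j)
    case 0
    then show ?case using cT[of 0] by simp
  next
    case (Suc j)
    have "sumset_mod p (T j) (T 0) \<subseteq> T (Suc j)"
    proof
      fix w assume "w \<in> sumset_mod p (T j) (T 0)"
      then obtain x y where w: "w = (x + y) mod int p" "x \<in> T j" "y \<in> T 0"
        by (auto simp: sumset_mod_def)
      have "sqrt (energy p B a x) \<le> real (Suc j) * sqrt l" "sqrt (energy p B a y) \<le> sqrt l"
        using w l real_sqrt_le_mono[of "energy p B a x" "(real (Suc j))\<^sup>2 * l"]
        by (auto simp: T_def level_set_def real_sqrt_mult)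
      then have "sqrt (energy p B a (x + y)) \<le> real (Suc j) * sqrt l + sqrt l"
        using sqrt_energy_add[of p B a x y] by linarith
      then have "sqrt (energy p B a w) \<le> real (Suc (Suc j)) * sqrt l"
        by (simp add: w(1) energy_mod algebra_simps)
      then have "(sqrt (energy p B a w))\<^sup>2 \<le> (real (Suc (Suc j)) * sqrt l)\<^sup>2"
        by (intro power_mono) auto
      then show "w \<in> T (Suc j)"
        using w p0 l by (simp add: T_def level_set_def residues_mod_def power_mult_distrib)
    qed
    then have "card (sumset_mod p (T j) (T 0)) \<le> card (T (Suc j))"
      by (intro card_mono finT)
    moreover have "min p (card (T j) + card (T 0) - 1) \<le> card (sumset_mod p (T j) (T 0))"
      using Cauchy_Davenport[OF p T_res _ T_res, of j 0] T0 by blast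
    ultimately show ?case using Suc.IH cT[of 0] cT[of j] by (auto simp: min_def split: if_splits)
  qed
  then show ?thesis by (simp add: T_def)
qed

text \<open>The sum telescopes from the first \<open>l\<close> with \<open>u \<le> Suc l\<close>,
  and this \<open>l\<close> is at most \<open>u\<close>. If \<open>u > K\<close>, the tail
  \<open>exp (- K / 4)\<close> alone dominates.\<close>

lemma layer_cake_lower:
  assumes "u \<ge> 0"
  shows "exp (- u / 4) \<le> (\<Sum>l<K. if u \<le> real (Suc l) then exp (- real l / 4) - exp (- real (Suc l) / 4) else 0)
     + exp (- real K / 4)"
proof (induction K)
  case 0
  then show ?case using assms by simp
next
  case (Suc K)
  show ?case
  proof (cases "u \<le> real (Suc K)")
    case False
    have "(\<Sum>l<Suc K. if u \<le> real (Suc l) then exp (- real l / 4) - exp (- real (Suc l) / 4) else 0) \<ge> 0"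
      by (intro sum_nonneg) auto
    moreover have "exp (- u / 4) \<le> exp (- real (Suc K) / 4)" using False by simp
    ultimately show ?thesis by linarith
  qed (use Suc in simp)
qed

text \<open>Rounding \<open>u\<close> down to a level costs a factor of at most
  \<open>exp (1 / 4) \<le> 2\<close>. The subtracted \<open>exp (- K / 4)\<close> is what lets the
  induction telescope.\<close>

lemma layer_cake_upper:
  assumes "u \<ge> 0"
  shows "(\<Sum>l<K. if u \<le> real (Suc l) then exp (- real l / 4) - exp (- real (Suc l) / 4) else 0)
     \<le> (if u \<le> real K then 2 * exp (- u / 4) - exp (- real K / 4) else 0)"
proof (induction K)
  case 0
  then show ?case using assms by simp
next
  case (Suc K)
  consider "u \<le> real K" | "real K < u" "u \<le> real (Suc K)" | "u > real (Suc K)" by linarith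
  then show ?case
  proof cases
    case 2
    have "exp (1 / 4 :: real) \<le> 2"
      using exp_bound[of "1/4 :: real"] by (simp add: power2_eq_square)
    then have "exp (1 / 4) * exp (- u / 4) \<le> 2 * exp (- u / 4)"
      by (intro mult_right_mono) auto
    moreover have "exp (- real K / 4) \<le> exp (1 / 4) * exp (- u / 4)"
      unfolding exp_add[symmetric] using 2 by simp
    ultimately have "exp (- real K / 4) \<le> 2 * exp (- u / 4)" by linarith
    then show ?thesis using Suc 2 by simp
  qed (use Suc in auto)
qed

lemma mean_mod_double:
  assumes "prime p" "odd p"
  shows "mean_mod p (\<lambda>x. f (2 * x mod int p)) = mean_mod p f"
proof -
  have p0: "p > 0" using assms prime_gt_0_nat by blast
  have inj: "inj_on (\<lambda>x. 2 * x mod int p) (residues_mod p)"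
  proof (rule inj_onI)
    fix x y assume xy: "x \<in> residues_mod p" "y \<in> residues_mod p" "2 * x mod int p = 2 * y mod int p"
    then have "int p dvd 2 * (x - y)" by (simp add: mod_eq_dvd_iff right_diff_distrib)
    moreover have "\<not> int p dvd 2"
    proof
      assume "int p dvd 2"
      then have "p \<le> 2" using zdvd_imp_le by fastforce
      then show False using assms prime_ge_2_nat[OF assms(1)] by (auto simp: le_antisym)
    qed
    ultimately have "int p dvd x - y" using prime_dvd_multD[of "int p" 2 "x - y"] assms(1) by auto
    moreover have "\<bar>x - y\<bar> < int p" using xy by (auto simp: residues_mod_def)
    ultimately have "x - y = 0" using dvd_imp_le_int[of "x - y" "int p"] by linarith
    then show "x = y" by simp
  qed
  moreover have "(\<lambda>x. 2 * x mod int p) ` residues_mod p \<subseteq> residues_mod p"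
    using p0 by (auto simp: residues_mod_def)
  ultimately have "bij_betw (\<lambda>x. 2 * x mod int p) (residues_mod p) (residues_mod p)"
    by (simp add: bij_betw_def endo_inj_surj)
  from sum.reindex_bij_betw[OF this, of f] show ?thesis by (simp add: mean_mod_def)
qed

text \<open>One has \<open>(cos t)^2 = 1 - (1 - cos (2 t)) / 2 \<le> exp (- (1 - cos (2 t)) /
  2)\<close>. The doubled frequency treats cosines near 1 and near -1 alike;
  \<open>mean_mod_double\<close> undoes the doubling.\<close>

lemma cos_product_mean_le_energy:
  assumes "prime p" "odd p" "finite B"
  shows "cos_product_mean p B a \<le> mean_mod p (\<lambda>x. exp (- energy p B a x / 4))"
proof -
  have "cos_product_mean p B a \<le> mean_mod p (\<lambda>x. exp (- energy p B a (2 * x mod int p) / 4))"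
    unfolding cos_product_mean_def
  proof (intro mean_mod_mono)
    fix x
    have "(\<Prod>i\<in>B. coschar p (x * a i)) \<le> (\<Prod>i\<in>B. \<bar>coschar p (x * a i)\<bar>)"
      by (metis abs_ge_self abs_prod)
    also have "\<dots> \<le> (\<Prod>i\<in>B. exp (- (1 - coschar p (2 * x * a i)) / 4))"
    proof (intro prod_mono conjI)
      fix i
      let ?c = "coschar p (x * a i)" and ?d = "coschar p (2 * x * a i)"
      have d: "?d = 2 * ?c\<^sup>2 - 1"
        using coschar_mult[of p "x * a i" "x * a i"] by (simp add: power2_eq_square algebra_simps)
      have "\<bar>?c\<bar>\<^sup>2 \<le> exp (- (1 - ?d) / 2)"
      proof -
        have "\<bar>?c\<bar>\<^sup>2 = 1 + - (1 - ?d) / 2" unfolding d by (simp add: diff_divide_distrib)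
        then show ?thesis using exp_ge_add_one_self[of "- (1 - ?d) / 2"] by linarith
      qed
      also have "\<dots> = (exp (- (1 - ?d) / 4))\<^sup>2"
        by (simp add: power2_eq_square flip: exp_add)
      finally show "\<bar>?c\<bar> \<le> exp (- (1 - ?d) / 4)" by (rule power2_le_imp_le) simp
    qed simp
    also have "\<dots> = exp (- energy p B a (2 * x) / 4)"
      using assms(3)
      by (simp add: energy_def exp_sum[symmetric] sum_divide_distrib minus_divide_left flip: sum_negf)
    finally show "(\<Prod>i\<in>B. coschar p (x * a i)) \<le> exp (- energy p B a (2 * x mod int p) / 4)"
      by (simp add: energy_mod)
  qed
  also have "\<dots> = mean_mod p (\<lambda>x. exp (- energy p B a x / 4))"
    by (rule mean_mod_double[OF assms(1,2)])
  finally show ?thesis .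
qed

text \<open>For \<open>u = (1 - cos) / (4 L^2)\<close> in \<open>[0, 1]\<close> one has
  \<open>exp (- u) \<le> 1 / (1 + u) \<le> 1 - u / 2\<close>, and the latter is exactly the lazy
  factor for time \<open>1 / (8 L^2)\<close>.\<close>

lemma exp_energy_le_lazy_factors:
  assumes "L \<ge> 1" "finite B"
  shows "exp (- (energy p B a x / (real L)\<^sup>2) / 4)
     \<le> (\<Prod>i\<in>B. 1 - 1 / (8 * (real L)\<^sup>2) + 1 / (8 * (real L)\<^sup>2) * coschar p (x * a i))"
proof -
  have L2: "(real L)\<^sup>2 \<ge> 1" using assms by (simp add: one_le_power)
  have "exp (- (energy p B a x / (real L)\<^sup>2) / 4)
      = (\<Prod>i\<in>B. exp (- ((1 - coschar p (x * a i)) / (4 * (real L)\<^sup>2))))"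
    using assms(2) by (simp add: energy_def exp_sum[symmetric] sum_negf sum_divide_distrib mult.commute)
  also have "\<dots> \<le> (\<Prod>i\<in>B. 1 - 1 / (8 * (real L)\<^sup>2) + 1 / (8 * (real L)\<^sup>2) * coschar p (x * a i))"
  proof (intro prod_mono conjI)
    fix i
    define u where "u = (1 - coschar p (x * a i)) / (4 * (real L)\<^sup>2)"
    have "1 - coschar p (x * a i) \<le> 2 * 1" using coschar_bounds(2)[of p "x * a i"] by simp
    also have "\<dots> \<le> 4 * (real L)\<^sup>2" using L2 by simp
    finally have u: "0 \<le> u" "u \<le> 1" using L2 by (auto simp: u_def divide_le_eq)
    have "u * u \<le> u" using u by (simp add: mult_left_le_one_le)
    then have "1 \<le> (1 - u / 2) * (1 + u)" by (simp add: algebra_simps)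
    then have "1 / (1 + u) \<le> 1 - u / 2" using u by (simp add: divide_le_eq)
    moreover have "exp (- u) \<le> 1 / (1 + u)"
      using exp_ge_add_one_self[of u] u by (simp add: exp_minus inverse_eq_divide frac_le)
    ultimately have "exp (- u) \<le> 1 - u / 2" by linarith
    also have "\<dots> = 1 - 1 / (8 * (real L)\<^sup>2) + 1 / (8 * (real L)\<^sup>2) * coschar p (x * a i)"
      by (simp add: u_def diff_divide_distrib)
    finally show "exp (- ((1 - coschar p (x * a i)) / (4 * (real L)\<^sup>2))) \<le> \<dots>"
      by (simp add: u_def)
  qed simp
  finally show ?thesis .
qed

text \<open>Halasz's inequality in the form: slowing the walk down by \<open>L\<^sup>2\<close> multiplies its return
  probability by about \<open>L\<close>.\<close>

lemma Halasz_slowdown: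
  assumes p: "prime p" "odd p" and B: "finite B" and L: "L \<ge> 1"
    and supp: "8 * k * L\<^sup>2 < card {i \<in> B. \<not> int p dvd a i}"
  shows "cos_product_mean p B a
     \<le> 1 / real p + exp (- 2 * real k) + 2 / real L * lazy_return p B (1 / (8 * (real L)\<^sup>2)) a"
proof -
  have p0: "p > 0" using p prime_gt_0_nat by blast
  define g where "g = energy p B a"
  define T where "T l = level_set p B a l" for l
  define w where "w l = exp (- real l / 4) - exp (- real (Suc l) / 4)" for l
  \<comment> \<open>Makes the truncation error \<open>exp (- K / 4)\<close> of the layer cake equal
    to \<open>exp (- 2 * k)\<close>.\<close>
  define K where "K = 8 * k"
  let ?R = "residues_mod p"
  have L0: "real L > 0" using L by simp
  have w0: "w l \<ge> 0" for l by (simp add: w_def)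
  \<comment> \<open>By orthogonality each coordinate that is nonzero modulo \<open>p\<close>
    contributes 1 to the average energy.\<close>
  have sum_g: "(\<Sum>x\<in>?R. g x) = p * card {i \<in> B. \<not> int p dvd a i}"
  proof -
    have "(\<Sum>x\<in>?R. g x) = (\<Sum>i\<in>B. \<Sum>x\<in>?R. 1 - coschar p (x * a i))"
      unfolding g_def energy_def by (rule sum.swap)
    also have "\<dots> = (\<Sum>i\<in>B. if \<not> int p dvd a i then real p else 0)"
      using p0 by (intro sum.cong) (auto simp: sum_subtractf sum_coschar)
    finally show ?thesis using B by (simp add: sum.If_cases Int_def)
  qed
  \<comment> \<open>If the level set up to \<open>L^2 (l + 1)\<close> were everything, the average
    energy would be at most \<open>L^2 K\<close>, below the support size. This excludes
    \<open>p\<close> as the minimum in the growth lemma.\<close>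
  have growth: "real (card (T (Suc l))) \<le> 1 + card (T ((real L)\<^sup>2 * Suc l)) / L" if l: "l < K" for l
  proof -
    have "card (T ((real L)\<^sup>2 * Suc l)) < p"
    proof (rule ccontr)
      assume "\<not> card (T ((real L)\<^sup>2 * Suc l)) < p"
      then have "T ((real L)\<^sup>2 * Suc l) = ?R"
        unfolding T_def by (intro card_seteq) (auto simp: level_set_subset)
      then have "(\<Sum>x\<in>?R. g x) \<le> (\<Sum>x\<in>?R. (real L)\<^sup>2 * Suc l)"
        by (intro sum_mono) (auto simp: T_def level_set_def g_def)
      also have "\<dots> = real (p * (L\<^sup>2 * Suc l))" by (simp add: algebra_simps)
      also have "\<dots> \<le> real (p * (L\<^sup>2 * K))" using l by (intro of_nat_mono mult_left_mono) auto
      also have "\<dots> < real (p * card {i \<in> B. \<not> int p dvd a i})"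
        using supp p0 by (simp add: K_def mult_ac del: of_nat_mult)
      finally show False using sum_g by simp
    qed
    moreover have "min p (L * (card (T (Suc l)) - 1) + 1) \<le> card (T ((real L)\<^sup>2 * Suc l))"
      using card_level_set_growth[OF p(1), of "Suc l" "L - 1" B a] L by (simp add: T_def)
    ultimately have "L * (card (T (Suc l)) - 1) \<le> card (T ((real L)\<^sup>2 * Suc l))" by linarith
    then have "real (L * (card (T (Suc l)) - 1)) \<le> card (T ((real L)\<^sup>2 * Suc l))"
      using of_nat_mono by blast
    then have "real (card (T (Suc l)) - 1) \<le> card (T ((real L)\<^sup>2 * Suc l)) / L"
      using L0 by (simp add: field_simps)
    then show ?thesis by linarith
  qed
  have "(\<Sum>x\<in>?R. exp (- g x / 4))
     \<le> (\<Sum>x\<in>?R. (\<Sum>l<K. if g x \<le> real (Suc l) then w l else 0) + exp (- real K / 4))"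
    unfolding w_def by (intro sum_mono layer_cake_lower) (simp add: g_def)
  also have "\<dots> = (\<Sum>l<K. w l * card (T (Suc l))) + p * exp (- 2 * real k)"
  proof -
    have "(\<Sum>x\<in>?R. \<Sum>l<K. if g x \<le> real (Suc l) then w l else 0)
       = (\<Sum>l<K. \<Sum>x\<in>?R. if g x \<le> real (Suc l) then w l else 0)" by (rule sum.swap)
    also have "\<dots> = (\<Sum>l<K. w l * card (T (Suc l)))"
      by (intro sum.cong refl) (simp add: sum.If_cases Int_def T_def level_set_def g_def)
    finally show ?thesis by (simp add: sum.distrib K_def)
  qed
  also have "\<dots> \<le> (\<Sum>l<K. w l * (1 + card (T ((real L)\<^sup>2 * Suc l)) / L)) + p * exp (- 2 * real k)"
    by (intro add_right_mono sum_mono mult_left_mono growth w0) auto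
  also have "\<dots> = (\<Sum>l<K. w l) + (\<Sum>l<K. w l * card (T ((real L)\<^sup>2 * Suc l))) / L + p * exp (- 2 * real k)"
    by (simp add: algebra_simps sum.distrib sum_divide_distrib)
  \<comment> \<open>The increments \<open>w\<close> sum to at most 1, which becomes the term
    \<open>1 / p\<close>. The enlarged level sets of \<open>g\<close> are level sets of
    \<open>g / L^2\<close>, and the upper layer-cake bound reassembles them.\<close>
  also have "\<dots> \<le> 1 + (\<Sum>x\<in>?R. 2 * exp (- (g x / (real L)\<^sup>2) / 4)) / L + p * exp (- 2 * real k)"
  proof (intro add_mono divide_right_mono order_refl)
    have "(\<Sum>l<K. w l) = 1 - exp (- real K / 4)"
      unfolding w_def by (induction K) simp_all
    then show "(\<Sum>l<K. w l) \<le> 1" by simp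
    have "(\<Sum>l<K. w l * card (T ((real L)\<^sup>2 * Suc l)))
       = (\<Sum>l<K. \<Sum>x\<in>?R. if g x / (real L)\<^sup>2 \<le> real (Suc l) then w l else 0)"
      using L0 by (intro sum.cong refl)
        (simp add: sum.If_cases Int_def T_def level_set_def g_def divide_le_eq mult.commute)
    also have "\<dots> = (\<Sum>x\<in>?R. \<Sum>l<K. if g x / (real L)\<^sup>2 \<le> real (Suc l) then w l else 0)"
      by (rule sum.swap)
    also have "\<dots> \<le> (\<Sum>x\<in>?R. 2 * exp (- (g x / (real L)\<^sup>2) / 4))"
    proof (rule sum_mono)
      fix x
      have "g x / (real L)\<^sup>2 \<ge> 0" by (simp add: g_def)
      from layer_cake_upper[OF this, of K]
      show "(\<Sum>l<K. if g x / (real L)\<^sup>2 \<le> real (Suc l) then w l else 0) \<le> 2 * exp (- (g x / (real L)\<^sup>2) / 4)"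
        unfolding w_def by (rule order_trans) simp
    qed
    finally show "(\<Sum>l<K. w l * card (T ((real L)\<^sup>2 * Suc l))) \<le> (\<Sum>x\<in>?R. 2 * exp (- (g x / (real L)\<^sup>2) / 4))" .
  qed simp
  also have "\<dots> \<le> 1 + (\<Sum>x\<in>?R. 2 * (\<Prod>i\<in>B. 1 - 1 / (8 * (real L)\<^sup>2) + 1 / (8 * (real L)\<^sup>2) * coschar p (x * a i))) / L
      + p * exp (- 2 * real k)"
    unfolding g_def
    by (intro add_mono divide_right_mono order_refl sum_mono mult_left_mono exp_energy_le_lazy_factors B L) auto
  also have "\<dots> = p * (1 / real p + exp (- 2 * real k) + 2 / real L * lazy_return p B (1 / (8 * (real L)\<^sup>2)) a)"
    using p0 by (simp add: lazy_return_def mean_mod_def sum_distrib_left[symmetric] algebra_simps)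
  finally have "mean_mod p (\<lambda>x. exp (- g x / 4))
     \<le> 1 / real p + exp (- 2 * real k) + 2 / real L * lazy_return p B (1 / (8 * (real L)\<^sup>2)) a"
    using p0 by (simp add: mean_mod_def divide_le_eq mult.commute)
  then show ?thesis using cos_product_mean_le_energy[OF p B, of a] unfolding g_def by linarith
qed

subsection \<open>Primes between powers of two\<close>

text \<open>The entries \<open>1 / (c * (r choose c))\<close> of Leibniz's harmonic triangle are integer combinations
  of \<open>1, 1/2, \<dots>, 1/r\<close>.\<close>

lemma Leibniz_triangle:
  assumes "1 \<le> c" "Suc c \<le> r"
  shows "1 / (real (Suc c) * real (r choose Suc c))
    = 1 / (real c * real ((r - 1) choose c)) - 1 / (real c * real (r choose c))"
proof -
  obtain q where r: "r = Suc q" using assms by (cases r) auto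
  have pos: "q choose c > 0" "Suc q choose c > 0" using assms r by (auto intro: zero_less_binomial)
  have 1: "real (Suc c) * real (Suc q choose Suc c) = real (Suc q) * real (q choose c)"
    by (metis Suc_times_binomial of_nat_mult)
  have "(Suc q - c) * (Suc q choose c) = Suc q * (q choose c)"
    by (metis Suc_times_binomial_eq binomial_absorb_comp diff_Suc_1 mult.commute)
  then have "real ((Suc q - c) * (Suc q choose c)) = real (Suc q * (q choose c))" by (rule arg_cong)
  then have 2: "(real (Suc q) - real c) * real (Suc q choose c) = real (Suc q) * real (q choose c)"
    using assms r unfolding of_nat_mult by (subst (asm) of_nat_diff) auto
  have "1 / (real c * real (q choose c)) - 1 / (real c * real (Suc q choose c))
     = (real (Suc q choose c) * real (Suc q) - real (Suc q) * real (q choose c)) /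
       (real (Suc q) * real c * real (q choose c) * real (Suc q choose c))"
    using pos assms by (simp add: divide_simps) (simp add: algebra_simps)
  also have "\<dots> = (real c * real (Suc q choose c)) /
       (real (Suc q) * real c * real (q choose c) * real (Suc q choose c))"
    using 2 by (simp add: algebra_simps)
  also have "\<dots> = 1 / (real (Suc q) * real (q choose c))"
    using pos assms by (simp add: divide_simps)
  finally show ?thesis using 1 r by simp
qed

lemma common_multiple_div_Leibniz_Ints:
  assumes D: "\<And>i. 1 \<le> i \<Longrightarrow> i \<le> r \<Longrightarrow> i dvd D" and c: "1 \<le> c" "c \<le> r"
  shows "real D / (real c * real (r choose c)) \<in> \<int>"
  using c D
proof (induction c arbitrary: r rule: nat_induct_at_least)
  case base
  then obtain q where "D = r * q" by (metis dvd_def le_refl)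
  then show ?case using base by simp
next
  case (Suc c)
  have "real D / (real c * real ((r - 1) choose c)) \<in> \<int>" "real D / (real c * real (r choose c)) \<in> \<int>"
    using Suc by auto
  moreover have "real D / (real (Suc c) * real (r choose Suc c))
    = real D / (real c * real ((r - 1) choose c)) - real D / (real c * real (r choose c))"
    using Leibniz_triangle[of c r] Suc by (simp only: divide_real_def right_diff_distrib[symmetric]) simp
  ultimately show ?case by (metis Ints_diff)
qed

text \<open>The witness is the least common multiple of \<open>1, ..., r\<close>: it has at most
  \<open>b\<close> prime divisors, and the power of each is at most \<open>r\<close>.\<close>

lemma common_multiple_le_power:
  fixes r b :: nat
  assumes r: "r \<ge> 1" and sm: "\<And>q. prime q \<Longrightarrow> q \<le> r \<Longrightarrow> q \<le> b"
  shows "\<exists>D. 0 < D \<and> D \<le> r ^ b \<and> (\<forall>i. 1 \<le> i \<longrightarrow> i \<le> r \<longrightarrow> i dvd D)"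
proof -
  define Q where "Q = {q. prime q \<and> q \<le> b}"
  define e where "e q = (GREATEST k. q ^ k \<le> r)" for q
  define D where "D = (\<Prod>q\<in>Q. q ^ e q)"
  have Q: "finite Q" "Q \<subseteq> {1..b}" using prime_ge_1_nat by (auto simp: Q_def)
  have bound: "k \<le> r" if "q \<in> Q" "q ^ k \<le> r" for q k
  proof -
    have "2 \<le> q" using that by (simp add: Q_def prime_ge_2_nat)
    then have "2 ^ k \<le> q ^ k" by (intro power_mono) auto
    then show ?thesis using that less_exp[of k] by linarith
  qed
  have e1: "q ^ e q \<le> r" if "q \<in> Q" for q
    unfolding e_def by (rule GreatestI_nat[where k = 0 and b = r]) (use r bound that in auto)
  have e2: "k \<le> e q" if "q \<in> Q" "q ^ k \<le> r" for q k
    unfolding e_def by (rule Greatest_le_nat[where b = r]) (use bound that in auto)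
  have "D \<le> (\<Prod>q\<in>Q. r)" unfolding D_def by (intro prod_mono) (use e1 in auto)
  also have "\<dots> = r ^ card Q" by simp
  also have "\<dots> \<le> r ^ b"
    using r card_mono[of "{1..b}" Q] Q by (intro power_increasing) auto
  finally have "D \<le> r ^ b" .
  moreover have "D > 0" unfolding D_def by (intro prod_pos) (auto simp: Q_def prime_gt_0_nat)
  moreover have "i dvd D" if i: "1 \<le> i" "i \<le> r" for i
  proof -
    have "i = (\<Prod>q\<in>prime_factors i. q ^ multiplicity q i)"
      using i by (intro prime_factorization_nat) auto
    also have "\<dots> dvd D" unfolding D_def
    proof (intro prod_dvd_prod_subset2 Q)
      show sub: "prime_factors i \<subseteq> Q"
      proof
        fix q assume "q \<in> prime_factors i"
        then have "prime q" "q dvd i" by auto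
        then show "q \<in> Q" using sm dvd_imp_le[of q i] i by (force simp: Q_def)
      qed
      fix q assume q: "q \<in> prime_factors i"
      have "q ^ multiplicity q i \<le> i" using i by (intro dvd_imp_le multiplicity_dvd) auto
      then show "q ^ multiplicity q i dvd q ^ e q"
        using e2[of q "multiplicity q i"] q sub i by (intro le_imp_power_dvd) auto
    qed
    finally show ?thesis .
  qed
  ultimately show ?thesis by blast
qed

text \<open>Without such a prime, \<open>1, ..., 2 N\<close> with \<open>N = 4 ^ t\<close> would
  have a common multiple of at most \<open>(2 N) ^ (2 ^ t)\<close>. But it is a positive multiple of
  \<open>N * (2 N choose N)\<close>, hence at least \<open>4 ^ N / 2\<close>.\<close>

lemma prime_between_powers_of_two:
  assumes "t \<ge> 1"
  shows "\<exists>p::nat. prime p \<and> 2 ^ t < p \<and> p \<le> 2 ^ (2 * t + 1)"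
proof (rule ccontr)
  assume no: "\<not> ?thesis"
  define N :: nat where "N = 4 ^ t"
  have N: "N \<ge> 1" "2 * N = 2 ^ (2 * t + 1)" by (simp_all add: N_def power_mult)
  have small: "q \<le> 2 ^ t" if "prime q" "q \<le> 2 * N" for q :: nat
    using no that N by (metis not_le)
  obtain D where D: "0 < D" "D \<le> (2 * N) ^ (2 ^ t)" "\<And>i. 1 \<le> i \<Longrightarrow> i \<le> 2 * N \<Longrightarrow> i dvd D"
    using common_multiple_le_power[of "2 * N" "2 ^ t"] small N by auto
  define x where "x = real N * real ((2 * N) choose N)"
  have x0: "x > 0" using N by (simp add: x_def zero_less_binomial)
  have "real D / x \<in> \<int>"
    unfolding x_def by (rule common_multiple_div_Leibniz_Ints) (use D N in auto)
  moreover have "real D / x > 0" using D x0 by simp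
  ultimately have "1 \<le> real D / x" by (auto elim!: Ints_cases)
  then have "x \<le> real D" using x0 by simp
  moreover have "4 ^ N / 2 \<le> x"
    using central_binomial_lower_bound[of N] N by (simp add: x_def field_simps)
  moreover have "real D \<le> real ((2 * N) ^ (2 ^ t))" using D(2) of_nat_mono by blast
  ultimately have "(4::real) ^ N / 2 \<le> (2 ^ (2 * t + 1)) ^ (2 ^ t)" unfolding N by simp
  then have "(4::real) ^ N \<le> 2 ^ ((2 * t + 1) * 2 ^ t + 1)"
    by (simp add: power_mult[symmetric] power_add)
  moreover have "(4::real) ^ N = 2 ^ (2 * N)" by (simp add: power_mult)
  ultimately have "(2::real) ^ (2 * N) \<le> 2 ^ ((2 * t + 1) * 2 ^ t + 1)" by argo
  then have "2 * N \<le> (2 * t + 1) * 2 ^ t + 1" by (subst (asm) power_increasing_iff) auto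
  \<comment> \<open>The exponents of two now clash: \<open>2 N = 2 * 2 ^ t * 2 ^ t\<close> is at
    least \<open>(2 t + 2) 2 ^ t\<close>, which exceeds \<open>(2 t + 1) 2 ^ t + 1\<close> because
    \<open>2 ^ t \<ge> 2\<close>.\<close>
  moreover have "(2 * t + 2) * 2 ^ t \<le> 2 * N"
  proof -
    have "t + 1 \<le> 2 ^ t" by (metis Suc_eq_plus1 Suc_leI less_exp)
    then have "2 * (t + 1) * 2 ^ t \<le> 2 * 2 ^ t * 2 ^ t" by (intro mult_mono) auto
    then show ?thesis using power_mult_distrib[of "2::nat" 2 t] by (simp add: N_def mult.assoc)
  qed
  moreover have "2 ^ t \<ge> (2::nat)" using assms self_le_power[of 2 t] by simp
  ultimately show False by (simp add: algebra_simps)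
qed

subsection \<open>Integer kernel vectors\<close>

text \<open>A maximal independent set \<open>S\<close> of columns has fewer than \<open>n\<close>
  elements. Used as rows and padded with zero rows it gives a singular square matrix; a kernel
  vector is orthogonal to \<open>S\<close>, hence to its span and to all columns.\<close>

lemma rank_less_imp_left_kernel:
  fixes A :: "real mat"
  assumes A: "A \<in> carrier_mat n m" and rk: "vec_space.rank n A < n"
  shows "\<exists>v \<in> carrier_vec n. v \<noteq> 0\<^sub>v n \<and> (\<forall>c \<in> set (cols A). c \<bullet> v = 0)"
proof -
  interpret vec_space "TYPE(real)" n .
  have cols: "set (cols A) \<subseteq> carrier_vec n" using cols_dim A by blast
  obtain S where S: "maximal S (\<lambda>T. T \<subseteq> set (cols A) \<and> lin_indpt T)" and finS: "finite S"
    using maximal_exists_superset[of "set (cols A)" "\<lambda>T. T \<subseteq> set (cols A) \<and> lin_indpt T" "{}"]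
      finite_lin_indpt2[of "{}"] by auto
  then have S1: "S \<subseteq> set (cols A)" "lin_indpt S" by (auto simp: maximal_def)
  have card: "card S < n" using rank_card_indpt[OF A S] rk by simp
  have Sc: "S \<subseteq> carrier_vec n" using S1 cols by blast
  obtain xs where xs: "set xs = S" "distinct xs" using finite_distinct_list[OF finS] by blast
  have lxs: "length xs < n" using card xs distinct_card by fastforce
  define ys where "ys = xs @ replicate (n - length xs) (0\<^sub>v n)"
  have ys: "length ys = n" "set ys \<subseteq> carrier_vec n" using lxs xs Sc by (auto simp: ys_def)
  define B where "B = mat_of_rows n ys"
  have B: "B \<in> carrier_mat n n" using ys mat_of_rows_carrier(1)[of n ys] by (simp add: B_def)
  have "ys ! (n - 1) = 0\<^sub>v n"
  proof -
    have "\<not> n - 1 < length xs" using lxs by linarith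
    then show ?thesis using lxs by (simp add: ys_def nth_append del: One_nat_def)
  qed
  then have row0: "row B (n - 1) = 0\<^sub>v n"
    using lxs ys by (simp add: B_def)
  \<comment> \<open>The last row is padding, so the transpose kills the last unit vector and the
    determinant vanishes.\<close>
  have "transpose_mat B *\<^sub>v unit_vec n (n - 1) = 0\<^sub>v n"
  proof (rule eq_vecI)
    fix i assume "i < dim_vec (0\<^sub>v n :: real vec)"
    then have i: "i < n" by simp
    have "(transpose_mat B *\<^sub>v unit_vec n (n - 1)) $ i = row B (n - 1) $ i"
      using i B lxs by (simp add: scalar_prod_right_unit)
    then show "(transpose_mat B *\<^sub>v unit_vec n (n - 1)) $ i = 0\<^sub>v n $ i" by (simp only: row0)
  qed (use B in simp)
  moreover have "unit_vec n (n - 1) \<noteq> (0\<^sub>v n :: real vec)"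
    using lxs by (metis diff_less index_unit_vec(1) index_zero_vec(1) less_numeral_extra(1)
        not_less_zero zero_less_one zero_neq_one linorder_neqE_nat)
  ultimately have "det (transpose_mat B) = 0"
    using B by (subst det_0_iff_vec_prod_zero[of _ n]) (auto intro!: exI[of _ "unit_vec n (n - 1)"])
  then have "det B = 0" using det_transpose[OF B] by simp
  then obtain v where v: "v \<in> carrier_vec n" "v \<noteq> 0\<^sub>v n" "B *\<^sub>v v = 0\<^sub>v n"
    using det_0_iff_vec_prod_zero[OF B] by blast
  have orth: "x \<bullet> v = 0" if "x \<in> S" for x
  proof -
    obtain i where i: "i < length xs" "x = xs ! i" using xs \<open>x \<in> S\<close> by (metis in_set_conv_nth)
    have "ys ! i = x" using i by (simp add: ys_def nth_append)
    moreover have "ys ! i \<in> carrier_vec n" using ys i lxs nth_mem[of i ys] by auto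
    ultimately have "row B i = x" using i lxs ys by (simp add: B_def)
    moreover have "(B *\<^sub>v v) $ i = row B i \<bullet> v" using i lxs B by (intro index_mult_mat_vec) auto
    ultimately show ?thesis using v i lxs by simp
  qed
  have "v \<in> orthogonal_complement S"
    using orth v Sc comm_scalar_prod[of v n] by (auto simp: orthogonal_complement_def)
  then have "v \<in> orthogonal_complement (span S)"
    by (simp only: in_orthogonal_complement_span[OF Sc])
  then have sub: "w \<bullet> v = 0" if "w \<in> span S" for w
    using that v span_closed[OF Sc that] comm_scalar_prod[of w n v] by (auto simp: orthogonal_complement_def)
  have "c \<bullet> v = 0" if c: "c \<in> set (cols A)" for c
  proof (cases "c \<in> S")
    case False
    have "c \<in> span S"
    proof (rule ccontr)
      assume "c \<notin> span S"
      then have "lin_indpt (S \<union> {c})"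
        using lin_dep_iff_in_span[of S c] S1 Sc c cols False by auto
      then have "S \<union> {c} = S" using S S1 c unfolding maximal_def by blast
      then show False using False by auto
    qed
    then show ?thesis using sub by blast
  qed (use orth in auto)
  then show ?thesis using v by blast
qed

text \<open>Simultaneous Dirichlet approximation with errors below \<open>1 / (n + 1)\<close>:
  paired with a column of signs, the integer vector gives an integer of absolute value less than 1,
  hence zero.\<close>

lemma integer_left_kernel:
  fixes A :: "nat \<Rightarrow> nat \<Rightarrow> real" and v :: "nat \<Rightarrow> real"
  assumes A: "\<And>i j. i < n \<Longrightarrow> j < m \<Longrightarrow> A i j \<in> {-1, 1}"
    and v: "\<exists>i<n. v i \<noteq> 0" "\<And>j. j < m \<Longrightarrow> (\<Sum>i<n. v i * A i j) = 0"
  shows "\<exists>z :: nat \<Rightarrow> int. (\<exists>i<n. z i \<noteq> 0) \<and> (\<forall>j<m. (\<Sum>i<n. of_int (z i) * A i j) = 0)"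
proof -
  obtain i0 where i0: "i0 < n" "v i0 \<noteq> 0" using v by auto
  define N where "N = n + 1"
  \<comment> \<open>Scaling by \<open>v i0\<close> makes coordinate \<open>i0\<close> equal to 1, so
    \<open>z i0\<close> is so close to \<open>q \<ge> 1\<close> that it cannot vanish.\<close>
  obtain q z where q: "0 < q" and z: "\<And>i. i < n \<Longrightarrow> \<bar>of_int q * (v i / v i0) - of_int (z i)\<bar> < 1 / N"
    by (rule Dirichlet_approx_simult[of N n "\<lambda>i. v i / v i0"]) (auto simp: N_def)
  have N1: "1 / real N \<le> 1 / 2" using i0 by (simp add: N_def)
  have "\<bar>real_of_int (q - z i0)\<bar> < 1" using z[OF i0(1)] i0 N1 by simp
  then have "z i0 \<noteq> 0" using q by auto
  moreover have "(\<Sum>i<n. of_int (z i) * A i j) = 0" if j: "j < m" for j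
  proof -
    let ?s = "\<Sum>i<n. of_int (z i) * A i j"
    have "?s \<in> \<int>" using A[OF _ j] by (intro Ints_sum Ints_mult) force+
    moreover have "\<bar>?s\<bar> < 1"
    proof -
      have "(\<Sum>i<n. of_int q * (v i / v i0) * A i j) = of_int q / v i0 * (\<Sum>i<n. v i * A i j)"
        by (simp add: sum_distrib_left field_simps)
      then have "?s = (\<Sum>i<n. (of_int (z i) - of_int q * (v i / v i0)) * A i j)"
        using v(2)[OF j] by (simp add: left_diff_distrib sum_subtractf)
      also have "\<bar>\<dots>\<bar> \<le> (\<Sum>i<n. \<bar>(of_int (z i) - of_int q * (v i / v i0)) * A i j\<bar>)" by (rule sum_abs)
      also have "\<dots> \<le> (\<Sum>i<n. 1 / N)"
      proof (intro sum_mono)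
        fix i assume "i \<in> {..<n}"
        then have "\<bar>A i j\<bar> = 1" "i < n" using A[OF _ j, of i] by auto
        then show "\<bar>(of_int (z i) - of_int q * (v i / v i0)) * A i j\<bar> \<le> 1 / N"
          using z[of i] by (simp add: abs_mult abs_minus_commute)
      qed
      also have "\<dots> < 1" by (simp add: N_def)
      finally show ?thesis .
    qed
    ultimately show ?thesis by (auto elim!: Ints_cases)
  qed
  ultimately show ?thesis using i0 by blast
qed

text \<open>Descent: if \<open>p\<close> divides all entries, division by \<open>p\<close> keeps the
  kernel relations and decreases the sum of the absolute values.\<close>

lemma integer_left_kernel_not_all_dvd:
  fixes A :: "nat \<Rightarrow> nat \<Rightarrow> real" and z :: "nat \<Rightarrow> int"
  assumes p: "p > 1"
    and z: "\<exists>i<n. z i \<noteq> 0" "\<And>j. j < m \<Longrightarrow> (\<Sum>i<n. of_int (z i) * A i j) = 0"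
  shows "\<exists>z :: nat \<Rightarrow> int. (\<exists>i<n. \<not> int p dvd z i) \<and> (\<forall>j<m. (\<Sum>i<n. of_int (z i) * A i j) = 0)"
  using z
proof (induction "\<Sum>i<n. nat \<bar>z i\<bar>" arbitrary: z rule: less_induct)
  case less
  show ?case
  proof (cases "\<exists>i<n. \<not> int p dvd z i")
    case True
    then show ?thesis using less.prems by blast
  next
    case False
    define y where "y i = z i div int p" for i
    have zy: "z i = int p * y i" if "i < n" for i using False that by (simp add: y_def)
    obtain i0 where i0: "i0 < n" "z i0 \<noteq> 0" using less.prems by auto
    have le: "nat \<bar>y i\<bar> \<le> nat \<bar>z i\<bar>" if "i < n" for i
      using p zy[OF that] by (auto simp: abs_mult nat_mult_distrib)
    have "y i0 \<noteq> 0" using i0 zy by auto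
    then have "nat \<bar>y i0\<bar> < nat \<bar>z i0\<bar>"
      using p zy[OF i0(1)] by (simp add: abs_mult nat_mult_distrib)
    then have "(\<Sum>i<n. nat \<bar>y i\<bar>) < (\<Sum>i<n. nat \<bar>z i\<bar>)"
      using i0 le by (intro sum_strict_mono_ex1) auto
    moreover have "(\<Sum>i<n. of_int (y i) * A i j) = 0" if "j < m" for j
    proof -
      have "real p * (\<Sum>i<n. of_int (y i) * A i j) = (\<Sum>i<n. of_int (z i) * A i j)"
        by (simp add: sum_distrib_left zy mult.assoc)
      then show ?thesis using less.prems(2)[OF that] p by simp
    qed
    ultimately show ?thesis using less.hyps[of y] \<open>y i0 \<noteq> 0\<close> i0 by blast
  qed
qed

subsection \<open>Sign vectors and sign matrices\<close>

text \<open>The default value 0 outside the index range is the convention of the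
  \<open>Pi_pmf\<close> in \<open>random_sign_matrix\<close>, so that in the matrix case the random
  entries are uniform on \<open>sign_mats\<close>.\<close>

definition sign_vecs :: "nat \<Rightarrow> (nat \<Rightarrow> real) set" where
  "sign_vecs n = PiE_dflt {..<n} 0 (\<lambda>_. {-1, 1})"

definition sign_mats :: "nat \<Rightarrow> nat \<Rightarrow> (nat \<times> nat \<Rightarrow> real) set" where
  "sign_mats n m = PiE_dflt ({..<n} \<times> {..<m}) 0 (\<lambda>_. {-1, 1})"

lemma finite_sign_vecs [simp]: "finite (sign_vecs n)"
  by (simp add: sign_vecs_def finite_PiE_dflt)

lemma finite_sign_mats [simp]: "finite (sign_mats n m)"
  by (simp add: sign_mats_def finite_PiE_dflt)

lemma card_sign_vecs: "card (sign_vecs n) = 2 ^ n"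
  by (simp add: sign_vecs_def card_PiE_dflt numeral_2_eq_2)

lemma card_sign_mats: "card (sign_mats n m) = 2 ^ (n * m)"
  by (simp add: sign_mats_def card_PiE_dflt numeral_2_eq_2)

lemma sum_sign_vecs_Suc:
  fixes f :: "(nat \<Rightarrow> real) \<Rightarrow> real"
  shows "(\<Sum>v\<in>sign_vecs (Suc n). f v) = (\<Sum>v\<in>sign_vecs n. f (v(n := 1)) + f (v(n := - 1)))"
proof -
  have "(\<Sum>v\<in>sign_vecs (Suc n). f v) = (\<Sum>(v, s)\<in>sign_vecs n \<times> {1, - 1}. f (v(n := s)))"
    by (rule sum.reindex_bij_witness[where i = "\<lambda>(v, s). v(n := s)" and j = "\<lambda>v. (v(n := 0), v n)"])
      (auto simp: sign_vecs_def PiE_dflt_def fun_eq_iff less_Suc_eq split: if_splits)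
  also have "\<dots> = (\<Sum>v\<in>sign_vecs n. \<Sum>s\<in>{1, - 1}. f (v(n := s)))"
    by (simp only: sum.cartesian_product)
  finally show ?thesis by simp
qed

text \<open>Independence of the columns in counting form; \<open>f\<close> depends on the column
  because the flips do.\<close>

lemma sum_sign_mats_prod:
  fixes f :: "nat \<Rightarrow> (nat \<Rightarrow> real) \<Rightarrow> real"
  shows "(\<Sum>X\<in>sign_mats n m. \<Prod>j<m. f j (\<lambda>i. X (i, j))) = (\<Prod>j<m. \<Sum>v\<in>sign_vecs n. f j v)"
proof (induction m)
  case 0
  have "sign_mats n 0 = {\<lambda>_. 0}" by (auto simp: sign_mats_def PiE_dflt_def)
  then show ?case by simp
next
  case (Suc m)
  \<comment> \<open>Glues \<open>v\<close> onto \<open>X\<close> as column \<open>m\<close>; the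
    inverse map resets that column to the default 0.\<close>
  let ?c = "\<lambda>X v ij. if snd ij = m then v (fst ij) else X ij :: real"
  have "(\<Sum>X\<in>sign_mats n (Suc m). \<Prod>j<Suc m. f j (\<lambda>i. X (i, j)))
    = (\<Sum>(X, v)\<in>sign_mats n m \<times> sign_vecs n. (\<Prod>j<m. f j (\<lambda>i. X (i, j))) * f m v)"
    by (rule sum.reindex_bij_witness[where i = "\<lambda>(X, v). ?c X v"
          and j = "\<lambda>X. ((\<lambda>ij. if snd ij = m then 0 else X ij), (\<lambda>i. X (i, m)))"];
      auto simp: sign_mats_def sign_vecs_def PiE_dflt_def fun_eq_iff less_Suc_eq split: if_splits
        intro!: prod.cong; metis)
  also have "\<dots> = (\<Sum>X\<in>sign_mats n m. \<Prod>j<m. f j (\<lambda>i. X (i, j))) * (\<Sum>v\<in>sign_vecs n. f m v)"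
    by (simp add: sum_product sum.cartesian_product)
  finally show ?case using Suc.IH by simp
qed

text \<open>The phase \<open>c\<close> carries the induction: the last sign changes it to
  \<open>c + \<beta> n\<close> or \<open>c - \<beta> n\<close>, and the two cosines add up to
  \<open>2 cos c cos (\<beta> n)\<close>.\<close>

lemma sum_cos_sign_vecs:
  "(\<Sum>v\<in>sign_vecs n. cos (c + (\<Sum>i<n. \<beta> i * v i))) = 2 ^ n * cos c * (\<Prod>i<n. cos (\<beta> i))"
proof (induction n arbitrary: c)
  case 0
  have "sign_vecs 0 = {\<lambda>_. 0}" by (auto simp: sign_vecs_def PiE_dflt_def)
  then show ?case by simp
next
  case (Suc n)
  have "(\<Sum>v\<in>sign_vecs (Suc n). cos (c + (\<Sum>i<Suc n. \<beta> i * v i)))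
     = (\<Sum>v\<in>sign_vecs n. cos (c + \<beta> n + (\<Sum>i<n. \<beta> i * v i)) + cos (c - \<beta> n + (\<Sum>i<n. \<beta> i * v i)))"
    unfolding sum_sign_vecs_Suc by (intro sum.cong refl) (simp add: algebra_simps)
  also have "\<dots> = 2 ^ n * (\<Prod>i<n. cos (\<beta> i)) * (cos (c + \<beta> n) + cos (c - \<beta> n))"
    by (simp only: sum.distrib Suc.IH) (simp add: algebra_simps)
  finally show ?case by (simp add: cos_add cos_diff)
qed

section \<open>Annihilation probability of a random column\<close>

definition annihilates :: "nat \<Rightarrow> nat \<Rightarrow> (nat \<Rightarrow> int) \<Rightarrow> (nat \<Rightarrow> real) \<Rightarrow> bool" where
  "annihilates p n a v \<longleftrightarrow> (\<Sum>i<n. of_int (a i) * v i) / real p \<in> \<int>"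

text \<open>Justifies the encoding in \<open>annihilates\<close>: sign vectors are real valued, so
  vanishing modulo \<open>p\<close> is expressed as integrality of a quotient.\<close>

lemma of_int_div_in_Ints_iff:
  assumes "p > 0"
  shows "real_of_int y / real p \<in> \<int> \<longleftrightarrow> int p dvd y"
proof
  assume "real_of_int y / real p \<in> \<int>"
  then obtain k where "real_of_int y / real p = of_int k" by (auto elim: Ints_cases)
  then have "real_of_int y = of_int (k * int p)" using assms by (simp add: field_simps)
  then have "y = k * int p" by (simp only: of_int_eq_iff)
  then show "int p dvd y" by simp
qed (use assms in \<open>auto elim!: dvdE\<close>)

text \<open>The indicator of divisibility by \<open>p\<close> is a mean of characters, and averaging
  over signs factors it into cosines. Cosine is even, so the flips \<open>\<sigma>\<close> leave the
  count unchanged; the union over flip sets rests on this.\<close>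

lemma card_annihilated:
  assumes p: "p > 0" and \<sigma>: "\<And>i. i < n \<Longrightarrow> \<sigma> i = 1 \<or> \<sigma> i = -1"
  shows "real (card {v \<in> sign_vecs n. annihilates p n a (\<lambda>i. \<sigma> i * v i)})
     = 2 ^ n * cos_product_mean p {..<n} a"
proof -
  have ind: "(if annihilates p n a (\<lambda>i. \<sigma> i * v i) then 1 else 0)
     = mean_mod p (\<lambda>x. cos (0 + (\<Sum>i<n. 2 * pi * of_int x * of_int (a i) * \<sigma> i / p * v i)))"
    if v: "v \<in> sign_vecs n" for v
  proof -
    let ?y = "\<Sum>i<n. of_int (a i) * (\<sigma> i * v i)"
    have "?y \<in> \<int>"
    proof (intro Ints_sum Ints_mult)
      fix i assume "i \<in> {..<n}"
      then show "\<sigma> i \<in> \<int>" "v i \<in> \<int>" using \<sigma>[of i] v by (auto simp: sign_vecs_def PiE_dflt_def) 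
    qed auto
    then obtain Y where Y: "?y = of_int Y" by (auto elim: Ints_cases)
    have "(\<Sum>i<n. 2 * pi * of_int x * of_int (a i) * \<sigma> i / p * v i) = 2 * pi * of_int (x * Y) / p" for x
    proof -
      have "(\<Sum>i<n. 2 * pi * of_int x * of_int (a i) * \<sigma> i / p * v i) = 2 * pi * of_int x / p * ?y"
        by (simp add: sum_distrib_left mult_ac)
      then show ?thesis by (simp add: Y)
    qed
    then have "mean_mod p (\<lambda>x. cos (0 + (\<Sum>i<n. 2 * pi * of_int x * of_int (a i) * \<sigma> i / p * v i)))
       = mean_mod p (\<lambda>x. coschar p (x * Y))" by (simp add: coschar_def)
    also have "\<dots> = (if int p dvd Y then 1 else 0)" using p by (simp add: mean_mod_coschar)
    finally show ?thesis using p by (simp add: annihilates_def Y of_int_div_in_Ints_iff)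
  qed
  have "real (card {v \<in> sign_vecs n. annihilates p n a (\<lambda>i. \<sigma> i * v i)})
     = (\<Sum>v\<in>sign_vecs n. if annihilates p n a (\<lambda>i. \<sigma> i * v i) then 1 else 0)"
    by (simp add: sum.If_cases Int_def)
  also have "\<dots> = mean_mod p (\<lambda>x. \<Sum>v\<in>sign_vecs n. cos (0 + (\<Sum>i<n. 2 * pi * of_int x * of_int (a i) * \<sigma> i / p * v i)))"
    unfolding mean_mod_def by (subst sum.swap) (simp add: ind mean_mod_def sum_divide_distrib)
  also have "\<dots> = mean_mod p (\<lambda>x. 2 ^ n * (\<Prod>i<n. coschar p (x * a i)))"
  proof -
    have "cos (2 * pi * of_int x * of_int (a i) * \<sigma> i / p) = coschar p (x * a i)" if "i < n" for x i
      using \<sigma>[OF that] by (auto simp: coschar_def mult_ac)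
    then show ?thesis unfolding sum_cos_sign_vecs by simp
  qed
  finally show ?thesis by (simp add: mean_mod_cmult cos_product_mean_def)
qed

text \<open>Flipping the sign at \<open>i\<close> changes the sum by \<open>2 * a i\<close> up to
  sign, nonzero modulo the odd \<open>p\<close>. So the annihilated vectors are disjoint from their
  images under this flip.\<close>

lemma card_annihilated_le_half:
  assumes p: "odd p" and i: "i < n" "\<not> int p dvd a i"
  shows "real (card {v \<in> sign_vecs n. annihilates p n a v}) \<le> 2 ^ n / 2"
proof -
  define Z where "Z = {v \<in> sign_vecs n. annihilates p n a v}"
  define \<phi> where "\<phi> v = v(i := - v i)" for v :: "nat \<Rightarrow> real"
  have p0: "p > 0" using p by (rule odd_pos)
  have inv: "\<phi> (\<phi> v) = v" for v by (simp add: \<phi>_def)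
  have sub: "Z \<union> \<phi> ` Z \<subseteq> sign_vecs n"
    using i by (auto simp: Z_def \<phi>_def sign_vecs_def PiE_dflt_def; metis)
  have "Z \<inter> \<phi> ` Z = {}"
  proof (rule ccontr)
    assume "\<not> ?thesis"
    then obtain v where v: "v \<in> Z" "\<phi> v \<in> Z" using inv by fastforce
    let ?s = "\<lambda>v. \<Sum>i<n. of_int (a i) * v i :: real"
    have s: "?s w = of_int (a i) * w i + (\<Sum>l\<in>{..<n} - {i}. of_int (a l) * w l)" for w
      using i by (subst sum.remove[of _ i]) auto
    have "(\<Sum>l\<in>{..<n} - {i}. of_int (a l) * \<phi> v l) = (\<Sum>l\<in>{..<n} - {i}. of_int (a l) * v l)"
      by (intro sum.cong) (auto simp: \<phi>_def)
    then have "?s v / p - ?s (\<phi> v) / p = of_int (2 * a i) * v i / p"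
      unfolding s by (simp add: \<phi>_def diff_divide_distrib[symmetric])
    moreover have "?s v / p - ?s (\<phi> v) / p \<in> \<int>" using v by (auto simp: Z_def annihilates_def)
    moreover have "v i = 1 \<or> v i = -1" using v i by (auto simp: Z_def sign_vecs_def PiE_dflt_def)
    ultimately have "real_of_int (2 * a i) / p \<in> \<int>" using minus_in_Ints_iff by fastforce
    then have "int p dvd 2 * a i" by (simp only: of_int_div_in_Ints_iff[OF p0])
    moreover have "coprime (int p) 2" using p by simp
    ultimately show False using i coprime_dvd_mult_right_iff by blast
  qed
  moreover have "card (\<phi> ` Z) = card Z" by (intro card_image inj_on_inverseI[of _ \<phi>]) (simp add: inv)
  moreover have "finite Z" by (simp add: Z_def)
  ultimately have "2 * card Z = card (Z \<union> \<phi> ` Z)" by (simp add: card_Un_disjoint)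
  also have "\<dots> \<le> 2 ^ n" using card_mono[OF _ sub] by (simp add: card_sign_vecs)
  finally have "real (2 * card Z) \<le> real (2 ^ n)" by (rule of_nat_mono)
  then show ?thesis by (simp add: Z_def)
qed

text \<open>Chernoff bound with exponential moment parameter \<open>\<epsilon>\<close>:
  independently, each column escapes annihilation with probability at least 1/2.\<close>

lemma card_few_nonzero_columns:
  fixes \<epsilon> :: real
  assumes p: "odd p" and i: "i < n" "\<not> int p dvd a i" and \<epsilon>: "0 < \<epsilon>"
  shows "real (card {X \<in> sign_mats n m.
      real (card {j. j < m \<and> \<not> annihilates p n a (\<lambda>i. X (i, j))}) < (1 - \<epsilon>) * (real m / 2)})
    \<le> 2 ^ (n * m) * exp (- (\<epsilon>\<^sup>2 / 4) * m)"
proof -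
  define y where "y = exp (- \<epsilon>)"
  define nz where "nz X = card {j. j < m \<and> \<not> annihilates p n a (\<lambda>i. X (i, j))}" for X
  define F where "F v = (if annihilates p n a v then 1 else y)" for v
  define Bad where "Bad = {X \<in> sign_mats n m. real (nz X) < (1 - \<epsilon>) * (real m / 2)}"
  define z where "z = real (card {v \<in> sign_vecs n. annihilates p n a v})"
  have y: "0 < y" "y \<le> 1 - \<epsilon> + \<epsilon>\<^sup>2 / 2" "y \<le> 1"
  proof -
    \<comment> \<open>The quadratic Taylor polynomials of \<open>exp \<epsilon>\<close> and
      \<open>exp (- \<epsilon>)\<close> multiply to \<open>1 + \<epsilon> ^ 4 / 4\<close>, which
      turns a lower bound for \<open>exp \<epsilon>\<close> into an upper bound for
      \<open>y\<close>.\<close>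
    have "1 \<le> 1 + \<epsilon> ^ 4 / 4" by simp
    also have "\<dots> = (1 + \<epsilon> + \<epsilon>\<^sup>2 / 2) * (1 - \<epsilon> + \<epsilon>\<^sup>2 / 2)" by (simp add: field_simps power2_eq_square power4_eq_xxxx)
    also have "\<dots> \<le> exp \<epsilon> * (1 - \<epsilon> + \<epsilon>\<^sup>2 / 2)"
    proof (rule mult_right_mono)
      show "1 + \<epsilon> + \<epsilon>\<^sup>2 / 2 \<le> exp \<epsilon>" using \<epsilon> exp_lower_Taylor_quadratic[of \<epsilon>] by simp
      have "0 \<le> ((1 - \<epsilon>)\<^sup>2 + 1) / 2" by simp
      also have "\<dots> = 1 - \<epsilon> + \<epsilon>\<^sup>2 / 2" by (simp add: power2_eq_square field_simps)
      finally show "0 \<le> 1 - \<epsilon> + \<epsilon>\<^sup>2 / 2" .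
    qed
    finally show "y \<le> 1 - \<epsilon> + \<epsilon>\<^sup>2 / 2" by (simp add: y_def exp_minus field_simps)
  qed (use \<epsilon> in \<open>auto simp: y_def\<close>)
  have "(\<Sum>v\<in>sign_vecs n. F v) = z + y * (2 ^ n - z)"
  proof -
    have "(\<Sum>v\<in>sign_vecs n. F v) = (\<Sum>v\<in>sign_vecs n. y + (1 - y) * (if annihilates p n a v then 1 else 0))"
      by (intro sum.cong) (auto simp: F_def)
    also have "\<dots> = y * 2 ^ n + (1 - y) * z"
      by (simp only: sum.distrib sum_distrib_left[symmetric])
        (simp add: sum.If_cases Int_def z_def card_sign_vecs)
    finally show ?thesis by (simp add: algebra_simps)
  qed
  also have "\<dots> = y * 2 ^ n + (1 - y) * z" by (simp add: algebra_simps)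
  also have "\<dots> \<le> y * 2 ^ n + (1 - y) * (2 ^ n / 2)"
    using card_annihilated_le_half[OF p, of i n a] i y by (intro add_mono mult_left_mono) (auto simp: z_def)
  also have "\<dots> = 2 ^ n * (1 + (- (1 - y) / 2))" by (simp add: field_simps)
  also have "\<dots> \<le> 2 ^ n * exp (- (1 - y) / 2)"
    by (intro mult_left_mono exp_ge_add_one_self) auto
  also have "\<dots> \<le> 2 ^ n * exp (- \<epsilon> / 2 + \<epsilon>\<^sup>2 / 4)" using y by simp
  finally have F: "(\<Sum>v\<in>sign_vecs n. F v) \<le> 2 ^ n * exp (- \<epsilon> / 2 + \<epsilon>\<^sup>2 / 4)" .
  have prodF: "(\<Prod>j<m. F (\<lambda>i. X (i, j))) = exp (- \<epsilon> * nz X)" for X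
  proof -
    have "(\<Prod>j<m. F (\<lambda>i. X (i, j))) = (\<Prod>j\<in>{j. j < m \<and> \<not> annihilates p n a (\<lambda>i. X (i, j))}. y)"
      unfolding F_def by (intro prod.mono_neutral_cong_right) auto
    then show ?thesis by (simp add: nz_def y_def exp_of_nat_mult[symmetric] mult.commute)
  qed
  have "real (card Bad) * exp (- \<epsilon> * ((1 - \<epsilon>) * (real m / 2))) = (\<Sum>X\<in>Bad. exp (- \<epsilon> * ((1 - \<epsilon>) * (real m / 2))))"
    by simp
  also have "\<dots> \<le> (\<Sum>X\<in>Bad. \<Prod>j<m. F (\<lambda>i. X (i, j)))"
    unfolding prodF using \<epsilon> by (intro sum_mono) (auto simp: Bad_def)
  also have "\<dots> \<le> (\<Sum>X\<in>sign_mats n m. \<Prod>j<m. F (\<lambda>i. X (i, j)))"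
    using y by (intro sum_mono2 prod_nonneg) (auto simp: Bad_def F_def)
  also have "\<dots> = (\<Sum>v\<in>sign_vecs n. F v) ^ m" using sum_sign_mats_prod[of "\<lambda>_. F"] by simp
  also have "\<dots> \<le> (2 ^ n * exp (- \<epsilon> / 2 + \<epsilon>\<^sup>2 / 4)) ^ m"
    using F y by (intro power_mono sum_nonneg) (auto simp: F_def)
  also have "\<dots> = 2 ^ (n * m) * exp (real m * (- \<epsilon> / 2 + \<epsilon>\<^sup>2 / 4))"
    by (simp add: power_mult_distrib power_mult exp_of_nat_mult)
  finally have "real (card Bad) \<le> 2 ^ (n * m) * exp (real m * (- \<epsilon> / 2 + \<epsilon>\<^sup>2 / 4)) / exp (- \<epsilon> * ((1 - \<epsilon>) * (real m / 2)))"
    by (simp add: pos_le_divide_eq)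
  also have "\<dots> = 2 ^ (n * m) * exp (real m * (- \<epsilon> / 2 + \<epsilon>\<^sup>2 / 4) - (- \<epsilon> * ((1 - \<epsilon>) * (real m / 2))))"
    by (simp only: exp_diff times_divide_eq_right)
  also have "real m * (- \<epsilon> / 2 + \<epsilon>\<^sup>2 / 4) - (- \<epsilon> * ((1 - \<epsilon>) * (real m / 2))) = - (\<epsilon>\<^sup>2 / 4) * m"
    by (simp add: field_simps power2_eq_square)
  finally show ?thesis by (simp add: Bad_def nz_def)
qed

text \<open>Give \<open>S\<close> the weight \<open>(1 / n) ^ card S\<close>. Each counted set
  weighs at least \<open>n powr (- \<kappa>)\<close>, and all subsets together weigh
  \<open>(1 + 1 / n) ^ (n * m) \<le> exp m\<close>.\<close>

lemma card_small_subsets: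
  fixes \<kappa> :: real
  assumes U: "finite U" "card U = n * m" and n: "n \<ge> 1"
  shows "real (card {S. S \<subseteq> U \<and> real (card S) < \<kappa>}) \<le> real n powr \<kappa> * exp (real m)"
proof -
  let ?A = "{S. S \<subseteq> U \<and> real (card S) < \<kappa>}"
  have "real (card ?A) * real n powr (- \<kappa>) = (\<Sum>S\<in>?A. real n powr (- \<kappa>))" by simp
  also have "\<dots> \<le> (\<Sum>S\<in>?A. (1 / real n) ^ card S)"
  proof (intro sum_mono)
    fix S assume "S \<in> ?A"
    then have "real n powr (- \<kappa>) \<le> real n powr (- real (card S))" using n by (intro powr_mono) auto
    also have "\<dots> = (1 / real n) ^ card S" using n by (simp add: powr_minus powr_realpow power_divide inverse_eq_divide)
    finally show "real n powr (- \<kappa>) \<le> (1 / real n) ^ card S" .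
  qed
  also have "\<dots> \<le> (\<Sum>S\<in>Pow U. (1 / real n) ^ card S)" using U by (intro sum_mono2) auto
  also have "\<dots> = (1 / real n + 1) ^ (n * m)"
    using prod_add[OF U(1), of "\<lambda>_. 1 / real n" "\<lambda>_. 1"] U by simp
  also have "\<dots> \<le> exp (1 / real n) ^ (n * m)"
    using exp_ge_add_one_self[of "1 / real n"] by (intro power_mono) (auto simp: add.commute)
  also have "\<dots> = exp (real m)" using n by (simp add: exp_of_nat_mult[symmetric])
  finally have "real (card ?A) * real n powr (- \<kappa>) \<le> exp (real m)" .
  then have "real (card ?A) * (real n powr (- \<kappa>) * real n powr \<kappa>) \<le> exp (real m) * real n powr \<kappa>"
    by (simp add: mult.assoc[symmetric] mult_right_mono)
  then show ?thesis using n by (simp add: powr_add[symmetric] mult.commute)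
qed

text \<open>Enlarge the support to a set \<open>T\<close> of exactly \<open>s\<close> indices: at
  most \<open>n ^ s\<close> choices of \<open>T\<close>, and \<open>p ^ s\<close> vectors on
  each.\<close>

lemma card_small_support:
  assumes "s \<le> n" "n \<ge> 1"
  shows "card {a \<in> vecs_mod p {..<n}. card {i \<in> {..<n}. \<not> int p dvd a i} \<le> s} \<le> (n * p) ^ s"
proof -
  define C where "C T = PiE {..<n} (\<lambda>i. if i \<in> T then residues_mod p else {0})" for T
  let ?I = "{T. T \<subseteq> {..<n} \<and> card T = s}"
  have fin: "finite ?I" by (rule finite_subset[of _ "Pow {..<n}"]) auto
  have finC: "finite (C T)" for T unfolding C_def by (rule finite_PiE) auto
  have "{a \<in> vecs_mod p {..<n}. card {i \<in> {..<n}. \<not> int p dvd a i} \<le> s} \<subseteq> (\<Union>T\<in>?I. C T)"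
  proof
    fix a assume "a \<in> {a \<in> vecs_mod p {..<n}. card {i \<in> {..<n}. \<not> int p dvd a i} \<le> s}"
    then have a: "a \<in> vecs_mod p {..<n}" "card {i \<in> {..<n}. \<not> int p dvd a i} \<le> s" by auto
    obtain T where T: "{i \<in> {..<n}. \<not> int p dvd a i} \<subseteq> T" "T \<subseteq> {..<n}" "card T = s"
      using exists_subset_between[of "{i \<in> {..<n}. \<not> int p dvd a i}" s "{..<n}"] a assms by auto
    have "a i = 0" if "i < n" "i \<notin> T" for i
    proof -
      have "int p dvd a i" "0 \<le> a i" "a i < int p"
        using that T a(1) by (auto simp: vecs_mod_def residues_mod_def PiE_def Pi_def)
      then show ?thesis using zdvd_imp_le[of "int p" "a i"] by linarith
    qed
    then have "a \<in> C T" using a(1) by (auto simp: vecs_mod_def C_def PiE_def Pi_def)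
    then show "a \<in> (\<Union>T\<in>?I. C T)" using T by auto
  qed
  then have "card {a \<in> vecs_mod p {..<n}. card {i \<in> {..<n}. \<not> int p dvd a i} \<le> s} \<le> card (\<Union>T\<in>?I. C T)"
    using fin finC by (intro card_mono) auto
  also have "\<dots> \<le> (\<Sum>T\<in>?I. card (C T))" by (rule card_UN_le[OF fin])
  also have "\<dots> = (\<Sum>T\<in>?I. p ^ s)"
  proof (intro sum.cong refl)
    fix T assume T: "T \<in> ?I"
    have "card (C T) = (\<Prod>i<n. if i \<in> T then p else 1)"
      unfolding C_def by (subst card_PiE) (auto intro!: prod.cong)
    also have "\<dots> = p ^ card ({..<n} \<inter> T)" by (simp add: prod.If_cases)
    also have "{..<n} \<inter> T = T" using T by auto
    finally show "card (C T) = p ^ s" using T by simp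
  qed
  also have "\<dots> = (n choose s) * p ^ s" by (simp add: n_subsets)
  also have "\<dots> \<le> n ^ s * p ^ s" by (intro mult_right_mono binomial_le_pow assms) auto
  finally show ?thesis by (simp add: power_mult_distrib)
qed

text \<open>Split at \<open>\<theta> = L / p\<close>. Below it the Halasz bound is at most
  \<open>4 / p\<close>, for at most \<open>p ^ n\<close> vectors. Above it the error
  \<open>2 / p\<close> is absorbed, leaving \<open>(4 / L) * H a\<close>, and
  \<open>sum_lazy_return_power_le\<close> applies.\<close>

lemma sum_cos_product_mean_power_le:
  assumes p: "prime p" "odd p" "real p \<le> exp (real k)" and L: "L \<ge> 2"
    and s: "s = 8 * k * L\<^sup>2" "s \<le> n" and k: "k \<ge> 1" and m: "n \<le> m"
  shows "(\<Sum>a\<in>{a \<in> vecs_mod p {..<n}. s < card {i \<in> {..<n}. \<not> int p dvd a i}}.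
       cos_product_mean p {..<n} a ^ m)
    \<le> real p ^ n * (4 / real p) ^ m + (4 / real L) ^ m * (2 * real k) ^ n * real p ^ s"
proof -
  define R where "R a = cos_product_mean p {..<n} a" for a
  \<comment> \<open>Together with \<open>s = 8 * k * L^2\<close> this gives
    \<open>\<tau> * s = k\<close>, hence a loss of \<open>2 * k\<close> per coordinate.\<close>
  define \<tau> where "\<tau> = 1 / (8 * (real L)\<^sup>2)"
  define H where "H a = lazy_return p {..<n} \<tau> a" for a
  define \<theta> where "\<theta> = real L / real p"
  define A where "A = {a \<in> vecs_mod p {..<n}. s < card {i \<in> {..<n}. \<not> int p dvd a i}}"
  have p0: "p > 0" using p prime_gt_0_nat by blast
  have "(real L)\<^sup>2 \<ge> 1" using L by (simp add: one_le_power)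
  then have "\<tau> \<le> 1 / 8" unfolding \<tau>_def using L by (intro divide_left_mono) auto
  moreover have "0 < \<tau>" "\<tau> * real s = real k" using L by (auto simp: \<tau>_def s(1))
  ultimately have \<tau>: "0 < \<tau>" "\<tau> \<le> 1 / 2" "\<tau> * real s = real k" by auto
  have pk: "exp (- real k) \<le> 1 / real p" using p p0 by (simp add: exp_minus field_simps)
  have \<theta>: "2 * exp (- (\<tau> * real s)) \<le> \<theta>"
  proof -
    have "2 * exp (- real k) \<le> 2 * (1 / real p)" using pk by simp
    also have "\<dots> \<le> \<theta>" using L p0 by (simp add: \<theta>_def divide_right_mono)
    finally show ?thesis by (simp add: \<tau>)
  qed
  \<comment> \<open>The cosines may be negative; nonnegativity comes from reading the mean as a
    probability.\<close>
  have R0: "R a \<ge> 0" for a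
  proof -
    have "R a = real (card {v \<in> sign_vecs n. annihilates p n a (\<lambda>i. 1 * v i)}) / 2 ^ n"
      using card_annihilated[OF p0, of n "\<lambda>_. 1" a] by (simp add: R_def)
    then show ?thesis by simp
  qed
  have H01: "0 \<le> H a" "H a \<le> 1" for a
    using \<tau> p0 by (auto simp: H_def intro: lazy_return_nonneg lazy_return_le_1)
  have R: "R a \<le> 2 / real p + 2 / real L * H a" if "a \<in> A" for a
  proof -
    have "R a \<le> 1 / real p + exp (- 2 * real k) + 2 / real L * H a"
      unfolding R_def H_def \<tau>_def
      using that p L s by (intro Halasz_slowdown) (auto simp: A_def)
    moreover have "exp (- 2 * real k) \<le> exp (- real k)" by simp
    moreover have "2 / real p = 1 / real p + 1 / real p" by simp
    ultimately show ?thesis using pk by linarith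
  qed
  have finA: "finite A" by (simp add: A_def)
  have "(\<Sum>a\<in>A. R a ^ m) = (\<Sum>a\<in>{a \<in> A. H a < \<theta>}. R a ^ m) + (\<Sum>a\<in>{a \<in> A. \<theta> \<le> H a}. R a ^ m)"
    using finA by (subst sum.union_disjoint[symmetric]) (auto intro!: sum.cong)
  also have "\<dots> \<le> real p ^ n * (4 / real p) ^ m + (4 / real L) ^ m * (2 * real k) ^ n * real p ^ s"
  proof (rule add_mono)
    have "(\<Sum>a\<in>{a \<in> A. H a < \<theta>}. R a ^ m) \<le> (\<Sum>a\<in>{a \<in> A. H a < \<theta>}. (4 / real p) ^ m)"
    proof (intro sum_mono power_mono R0)
      fix a assume a: "a \<in> {a \<in> A. H a < \<theta>}"
      then have "2 / real L * H a \<le> 2 / real L * \<theta>" by (intro mult_left_mono) auto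
      also have "\<dots> = 2 / real p" using L by (simp add: \<theta>_def)
      finally show "R a \<le> 4 / real p" using R[of a] a by simp
    qed
    also have "\<dots> = real (card {a \<in> A. H a < \<theta>}) * (4 / real p) ^ m" by simp
    also have "\<dots> \<le> real p ^ n * (4 / real p) ^ m"
    proof (intro mult_right_mono)
      have "card {a \<in> A. H a < \<theta>} \<le> card (vecs_mod p {..<n})" by (intro card_mono) (auto simp: A_def)
      then have "real (card {a \<in> A. H a < \<theta>}) \<le> real (p ^ n)"
        unfolding card_vecs_mod[OF finite_lessThan] card_lessThan by (rule of_nat_mono)
      then show "real (card {a \<in> A. H a < \<theta>}) \<le> real p ^ n" by simp
    qed auto
    finally show "(\<Sum>a\<in>{a \<in> A. H a < \<theta>}. R a ^ m) \<le> real p ^ n * (4 / real p) ^ m" .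
  next
    have "(\<Sum>a\<in>{a \<in> A. \<theta> \<le> H a}. R a ^ m) \<le> (\<Sum>a\<in>{a \<in> A. \<theta> \<le> H a}. (4 / real L) ^ m * H a ^ (n - s))"
    proof (intro sum_mono)
      fix a assume a: "a \<in> {a \<in> A. \<theta> \<le> H a}"
      then have "1 / real p \<le> H a / real L" using L p0 by (simp add: \<theta>_def field_simps)
      moreover have "R a \<le> 2 * (1 / real p) + 2 * (H a / real L)" using R[of a] a by simp
      ultimately have "R a \<le> 4 * (H a / real L)" by linarith
      then have "R a \<le> 4 / real L * H a" by simp
      then have "R a ^ m \<le> (4 / real L * H a) ^ m" by (intro power_mono R0)
      also have "\<dots> = (4 / real L) ^ m * H a ^ m" by (rule power_mult_distrib)
      \<comment> \<open>As \<open>H a \<le> 1\<close>, the exponent may be lowered to the one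
        provided by the counting lemma.\<close>
      also have "\<dots> \<le> (4 / real L) ^ m * H a ^ (n - s)"
        using H01 m by (intro mult_left_mono power_decreasing) auto
      finally show "R a ^ m \<le> (4 / real L) ^ m * H a ^ (n - s)" .
    qed
    also have "\<dots> \<le> (\<Sum>a\<in>{a \<in> vecs_mod p {..<n}. \<theta> \<le> H a}. (4 / real L) ^ m * H a ^ (n - s))"
      using H01 by (intro sum_mono2) (auto simp: A_def)
    also have "\<dots> = (4 / real L) ^ m * (\<Sum>a\<in>{a \<in> vecs_mod p {..<n}. \<theta> \<le> H a}. H a ^ (n - s))"
      by (simp add: sum_distrib_left)
    also have "\<dots> \<le> (4 / real L) ^ m * ((2 * real k) ^ (n - s) * real p ^ s)"
      using sum_lazy_return_power_le[OF p0 \<tau>(1,2) \<theta>, of "{..<n}"] s(2)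
      by (intro mult_left_mono) (auto simp: H_def \<tau>(3))
    also have "\<dots> \<le> (4 / real L) ^ m * ((2 * real k) ^ n * real p ^ s)"
      using k by (intro mult_left_mono mult_right_mono power_increasing) auto
    finally show "(\<Sum>a\<in>{a \<in> A. \<theta> \<le> H a}. R a ^ m) \<le> (4 / real L) ^ m * (2 * real k) ^ n * real p ^ s"
      by (simp add: mult.assoc)
  qed
  finally show ?thesis by (simp add: A_def R_def)
qed

subsection \<open>Union bound over flips and kernel vectors\<close>

text \<open>Rank deficiency gives a real kernel vector, then an integer one, then one not entirely
  divisible by \<open>p\<close>; reduction modulo \<open>p\<close> changes each column sum by a
  multiple of \<open>p\<close>.\<close>

lemma low_rank_flip_imp_annihilated:
  assumes X: "X \<in> sign_mats n m" and p: "p > 1"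
    and rk: "vec_space.rank n (flip_entries S (mat n m X)) < n"
  shows "\<exists>a\<in>vecs_mod p {..<n}. (\<exists>i<n. \<not> int p dvd a i) \<and>
    (\<forall>j<m. annihilates p n a (\<lambda>i. (if (i, j) \<in> S then -1 else 1) * X (i, j)))"
proof -
  define M where "M i j = (if (i, j) \<in> S then -1 else 1) * X (i, j)" for i j
  have M: "M i j \<in> {-1, 1}" if "i < n" "j < m" for i j
    using X that by (auto simp: M_def sign_mats_def PiE_dflt_def)
  define A where "A = flip_entries S (mat n m X)"
  have A: "A \<in> carrier_mat n m" by (simp add: A_def flip_entries_def)
  have Aij: "A $$ (i, j) = M i j" if "i < n" "j < m" for i j
    using that by (simp add: A_def flip_entries_def M_def)
  obtain v where v: "v \<in> carrier_vec n" "v \<noteq> 0\<^sub>v n" "\<And>c. c \<in> set (cols A) \<Longrightarrow> c \<bullet> v = 0"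
    using rank_less_imp_left_kernel[OF A] rk by (auto simp: A_def)
  have "\<exists>i<n. v $ i \<noteq> 0"
  proof (rule ccontr)
    assume "\<not> ?thesis"
    then have "v = 0\<^sub>v n" using v(1) by (intro eq_vecI) auto
    then show False using v by simp
  qed
  moreover have "(\<Sum>i<n. v $ i * M i j) = 0" if j: "j < m" for j
  proof -
    have "col A j \<in> set (cols A)" using A j by (auto simp: cols_def)
    then have "col A j \<bullet> v = 0" by (rule v(3))
    moreover have "col A j \<bullet> v = (\<Sum>i<n. v $ i * M i j)"
      using A v(1) j by (auto simp: scalar_prod_def Aij lessThan_atLeast0 mult.commute intro!: sum.cong)
    ultimately show ?thesis by simp
  qed
  ultimately obtain z :: "nat \<Rightarrow> int" where "\<exists>i<n. z i \<noteq> 0" "\<And>j. j < m \<Longrightarrow> (\<Sum>i<n. of_int (z i) * M i j) = 0"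
    using integer_left_kernel[of n m M "\<lambda>i. v $ i"] M by blast
  then obtain z :: "nat \<Rightarrow> int" where z: "\<exists>i<n. \<not> int p dvd z i" "\<And>j. j < m \<Longrightarrow> (\<Sum>i<n. of_int (z i) * M i j) = 0"
    using integer_left_kernel_not_all_dvd[OF p, of n z m M] by blast
  define a where "a = (\<lambda>i\<in>{..<n}. z i mod int p)"
  have "a \<in> vecs_mod p {..<n}" using p by (auto simp: a_def vecs_mod_def residues_mod_def)
  moreover have "\<exists>i<n. \<not> int p dvd a i" using z(1) by (auto simp: a_def dvd_mod_iff)
  moreover have "annihilates p n a (\<lambda>i. M i j)" if j: "j < m" for j
  proof -
    have "real_of_int (a i) = of_int (z i) - real p * of_int (z i div int p)" if "i < n" for i
      using that by (simp add: a_def minus_mult_div_eq_mod[symmetric])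
    then have "(\<Sum>i<n. of_int (a i) * M i j)
       = (\<Sum>i<n. of_int (z i) * M i j) - real p * (\<Sum>i<n. of_int (z i div int p) * M i j)"
      by (simp add: left_diff_distrib sum_subtractf sum_distrib_left mult.assoc)
    then have "(\<Sum>i<n. of_int (a i) * M i j) / p = - (\<Sum>i<n. of_int (z i div int p) * M i j)"
      using z(2)[OF j] p by simp
    moreover have "(\<Sum>i<n. of_int (z i div int p) * M i j) \<in> \<int>"
      using M[OF _ j] by (intro Ints_sum Ints_mult) force+
    ultimately show ?thesis by (simp add: annihilates_def)
  qed
  ultimately show ?thesis unfolding M_def by blast
qed

text \<open>For small support the flip sets are not enumerated: fewer than \<open>\<kappa>\<close>
  flips touch fewer than \<open>\<kappa>\<close> columns, so \<open>a\<close> annihilates all other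
  columns of the unflipped matrix. For large support all pairs of a flip set and a vector are
  enumerated.\<close>

lemma card_fragile_le:
  fixes \<epsilon> :: real
  assumes p: "prime p" "odd p" "real p \<le> exp (real k)" and L: "L \<ge> 2"
    and s: "s = 8 * k * L\<^sup>2" "s \<le> n" and k: "k \<ge> 1" and n: "n \<ge> 1" "n \<le> m"
    and \<epsilon>: "0 < \<epsilon>"
  defines "\<kappa> \<equiv> (1 - \<epsilon>) * (real m / 2)"
  shows "real (card {X \<in> sign_mats n m. \<exists>S \<subseteq> {..<n} \<times> {..<m}. real (card S) < \<kappa> \<and>
            vec_space.rank n (flip_entries S (mat n m X)) < n})
    \<le> 2 ^ (n * m) * ((real n * real p) ^ s * exp (- (\<epsilon>\<^sup>2 / 4) * m)
       + real n powr \<kappa> * exp m * (real p ^ n * (4 / real p) ^ m + (4 / real L) ^ m * (2 * real k) ^ n * real p ^ s))"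
proof -
  have p1: "p > 1" "p > 0" using p prime_gt_1_nat prime_gt_0_nat by auto
  define U where "U = {..<n} \<times> {..<m}"
  define supp where "supp a = card {i \<in> {..<n}. \<not> int p dvd a i}" for a
  define A1 where "A1 = {a \<in> vecs_mod p {..<n}. supp a \<le> s \<and> (\<exists>i<n. \<not> int p dvd a i)}"
  define A2 where "A2 = {a \<in> vecs_mod p {..<n}. s < supp a}"
  define \<S> where "\<S> = {S. S \<subseteq> U \<and> real (card S) < \<kappa>}"
  define \<sigma> where "\<sigma> S i j = (if (i, j) \<in> S then -1 else 1 :: real)" for S :: "(nat \<times> nat) set" and i j
  define B1 where "B1 a = {X \<in> sign_mats n m. real (card {j. j < m \<and> \<not> annihilates p n a (\<lambda>i. X (i, j))}) < \<kappa>}" for a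
  define B2 where "B2 S a = {X \<in> sign_mats n m. \<forall>j<m. annihilates p n a (\<lambda>i. \<sigma> S i j * X (i, j))}" for S a
  define Bad where "Bad = {X \<in> sign_mats n m. \<exists>S \<subseteq> U. real (card S) < \<kappa> \<and>
            vec_space.rank n (flip_entries S (mat n m X)) < n}"
  have U: "finite U" "card U = n * m" by (auto simp: U_def)
  have fin: "finite A1" "finite A2" "finite \<S>" using U by (auto simp: A1_def A2_def \<S>_def)
  have "Bad \<subseteq> (\<Union>a\<in>A1. B1 a) \<union> (\<Union>S\<in>\<S>. \<Union>a\<in>A2. B2 S a)"
  proof
    fix X assume "X \<in> Bad"
    then obtain S where X: "X \<in> sign_mats n m" and S: "S \<subseteq> U" "real (card S) < \<kappa>"
      "vec_space.rank n (flip_entries S (mat n m X)) < n" by (auto simp: Bad_def)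
    obtain a where a: "a \<in> vecs_mod p {..<n}" "\<exists>i<n. \<not> int p dvd a i"
      "\<And>j. j < m \<Longrightarrow> annihilates p n a (\<lambda>i. \<sigma> S i j * X (i, j))"
      using low_rank_flip_imp_annihilated[OF X p1(1) S(3)] unfolding \<sigma>_def by blast
    show "X \<in> (\<Union>a\<in>A1. B1 a) \<union> (\<Union>S\<in>\<S>. \<Union>a\<in>A2. B2 S a)"
    proof (cases "supp a \<le> s")
      case True
      have "{j. j < m \<and> \<not> annihilates p n a (\<lambda>i. X (i, j))} \<subseteq> snd ` S"
      proof
        fix j assume j: "j \<in> {j. j < m \<and> \<not> annihilates p n a (\<lambda>i. X (i, j))}"
        show "j \<in> snd ` S"
        proof (rule ccontr)
          assume "j \<notin> snd ` S"
          then have "\<sigma> S i j = 1" for i by (force simp: \<sigma>_def)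
          then show False using a(3)[of j] j by simp
        qed
      qed
      moreover have "finite S" using S U finite_subset by blast
      ultimately have "card {j. j < m \<and> \<not> annihilates p n a (\<lambda>i. X (i, j))} \<le> card S"
        by (meson card_image_le card_mono finite_imageI order_trans)
      then have "X \<in> B1 a" using S X by (simp add: B1_def)
      then show ?thesis using True a by (auto simp: A1_def)
    next
      case False
      then have "a \<in> A2" "S \<in> \<S>" "X \<in> B2 S a" using a S X by (auto simp: A2_def B2_def \<S>_def)
      then show ?thesis by blast
    qed
  qed
  then have "card Bad \<le> card ((\<Union>a\<in>A1. B1 a) \<union> (\<Union>S\<in>\<S>. \<Union>a\<in>A2. B2 S a))"
    using fin by (intro card_mono) (auto simp: B1_def B2_def)
  also have "\<dots> \<le> (\<Sum>a\<in>A1. card (B1 a)) + (\<Sum>S\<in>\<S>. \<Sum>a\<in>A2. card (B2 S a))"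
    by (intro order_trans[OF card_Un_le] add_mono order_trans[OF card_UN_le] sum_mono fin order_refl)
  finally have "real (card Bad) \<le> (\<Sum>a\<in>A1. real (card (B1 a))) + (\<Sum>S\<in>\<S>. \<Sum>a\<in>A2. real (card (B2 S a)))"
    using of_nat_mono by fastforce
  also have "\<dots> \<le> (real n * real p) ^ s * (2 ^ (n * m) * exp (- (\<epsilon>\<^sup>2 / 4) * m))
      + real n powr \<kappa> * exp m * (2 ^ (n * m) * (real p ^ n * (4 / real p) ^ m + (4 / real L) ^ m * (2 * real k) ^ n * real p ^ s))"
  proof (rule add_mono)
    have "(\<Sum>a\<in>A1. real (card (B1 a))) \<le> (\<Sum>a\<in>A1. 2 ^ (n * m) * exp (- (\<epsilon>\<^sup>2 / 4) * m))"
    proof (rule sum_mono)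
      fix a assume "a \<in> A1"
      then obtain i where "i < n" "\<not> int p dvd a i" by (auto simp: A1_def)
      then show "real (card (B1 a)) \<le> 2 ^ (n * m) * exp (- (\<epsilon>\<^sup>2 / 4) * m)"
        unfolding B1_def \<kappa>_def using p \<epsilon> by (intro card_few_nonzero_columns) auto
    qed
    also have "\<dots> = real (card A1) * (2 ^ (n * m) * exp (- (\<epsilon>\<^sup>2 / 4) * m))" by simp
    also have "\<dots> \<le> (real n * real p) ^ s * (2 ^ (n * m) * exp (- (\<epsilon>\<^sup>2 / 4) * m))"
    proof (intro mult_right_mono)
      have "card A1 \<le> card {a \<in> vecs_mod p {..<n}. card {i \<in> {..<n}. \<not> int p dvd a i} \<le> s}"
        by (intro card_mono) (auto simp: A1_def supp_def)
      also have "\<dots> \<le> (n * p) ^ s" using s n by (intro card_small_support) auto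
      finally have "real (card A1) \<le> real ((n * p) ^ s)" by (rule of_nat_mono)
      then show "real (card A1) \<le> (real n * real p) ^ s" by simp
    qed auto
    finally show "(\<Sum>a\<in>A1. real (card (B1 a))) \<le> (real n * real p) ^ s * (2 ^ (n * m) * exp (- (\<epsilon>\<^sup>2 / 4) * m))" .
  next
    have cB2: "real (card (B2 S a)) = 2 ^ (n * m) * cos_product_mean p {..<n} a ^ m" for S a
    proof -
      have "real (card (B2 S a)) = (\<Sum>X\<in>sign_mats n m. \<Prod>j<m. if annihilates p n a (\<lambda>i. \<sigma> S i j * X (i, j)) then 1 else 0)"
      proof -
        have "(\<Prod>j<m. if annihilates p n a (\<lambda>i. \<sigma> S i j * X (i, j)) then 1 else 0 :: real)
          = (if \<forall>j<m. annihilates p n a (\<lambda>i. \<sigma> S i j * X (i, j)) then 1 else 0)" for X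
          by auto
        then show ?thesis by (simp add: sum.If_cases Int_def B2_def)
      qed
      also have "\<dots> = (\<Prod>j<m. \<Sum>v\<in>sign_vecs n. if annihilates p n a (\<lambda>i. \<sigma> S i j * v i) then 1 else 0)"
        by (rule sum_sign_mats_prod)
      also have "\<dots> = (\<Prod>j<m. real (card {v \<in> sign_vecs n. annihilates p n a (\<lambda>i. \<sigma> S i j * v i)}))"
        by (simp add: sum.If_cases Int_def)
      also have "\<dots> = (\<Prod>j<m. 2 ^ n * cos_product_mean p {..<n} a)"
        by (intro prod.cong refl card_annihilated p1) (auto simp: \<sigma>_def)
      finally show ?thesis by (simp add: power_mult_distrib power_mult)
    qed
    let ?T = "real p ^ n * (4 / real p) ^ m + (4 / real L) ^ m * (2 * real k) ^ n * real p ^ s"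
    have "(\<Sum>S\<in>\<S>. \<Sum>a\<in>A2. real (card (B2 S a)))
       = real (card \<S>) * (2 ^ (n * m) * (\<Sum>a\<in>A2. cos_product_mean p {..<n} a ^ m))"
      by (simp add: cB2 sum_distrib_left)
    also have "\<dots> \<le> real (card \<S>) * (2 ^ (n * m) * ?T)"
      unfolding A2_def supp_def using p L s k n
      by (intro mult_left_mono sum_cos_product_mean_power_le) auto
    also have "\<dots> \<le> real n powr \<kappa> * exp m * (2 ^ (n * m) * ?T)"
      unfolding \<S>_def using U n by (intro mult_right_mono card_small_subsets) auto
    finally show "(\<Sum>S\<in>\<S>. \<Sum>a\<in>A2. real (card (B2 S a))) \<le> real n powr \<kappa> * exp m * (2 ^ (n * m) * ?T)" .
  qed
  also have "\<dots> = 2 ^ (n * m) * ((real n * real p) ^ s * exp (- (\<epsilon>\<^sup>2 / 4) * m)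
       + real n powr \<kappa> * exp m * (real p ^ n * (4 / real p) ^ m + (4 / real L) ^ m * (2 * real k) ^ n * real p ^ s))"
    by (simp only: distrib_left mult_ac)
  finally show ?thesis by (simp only: Bad_def U_def)
qed

text \<open>A nonempty set of extended naturals attains its infimum, and the empty set yields
  infinity, which is not below \<open>r\<close>.\<close>

lemma Res_less_imp:
  assumes "ereal_of_enat (Res (mat n m X)) < ereal r"
  shows "\<exists>S \<subseteq> {..<n} \<times> {..<m}. real (card S) < r \<and> vec_space.rank n (flip_entries S (mat n m X)) < n"
proof -
  let ?A = "{enat (card S) | S. S \<subseteq> {..<n} \<times> {..<m} \<and> vec_space.rank n (flip_entries S (mat n m X)) < n}"
  have R: "Res (mat n m X) = Inf ?A" by (simp add: Res_def)
  have "?A \<noteq> {}"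
  proof
    assume "?A = {}"
    then have "Res (mat n m X) = \<infinity>" unfolding R by (simp only: Inf_empty top_enat_def)
    then show False using assms by simp
  qed
  then have "Inf ?A \<in> ?A" by (metis (no_types, lifting) Inf_enat_def LeastI_ex ex_in_conv)
  then obtain S where S: "Inf ?A = enat (card S)" "S \<subseteq> {..<n} \<times> {..<m}"
    "vec_space.rank n (flip_entries S (mat n m X)) < n" by blast
  have "real (card S) < r" using assms unfolding R S(1) by simp
  then show ?thesis using S by blast
qed

lemma prob_Res_less_le:
  "measure_pmf.prob (random_sign_matrix n m) {M. \<not> ereal r \<le> ereal_of_enat (Res M)}
   \<le> real (card {X \<in> sign_mats n m. \<exists>S \<subseteq> {..<n} \<times> {..<m}. real (card S) < r \<and>
            vec_space.rank n (flip_entries S (mat n m X)) < n}) / 2 ^ (n * m)"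
proof -
  let ?B = "{X. \<exists>S \<subseteq> {..<n} \<times> {..<m}. real (card S) < r \<and> vec_space.rank n (flip_entries S (mat n m X)) < n}"
  have Pi: "Pi_pmf ({..<n} \<times> {..<m}) 0 (\<lambda>_. pmf_of_set {-1, 1 :: real}) = pmf_of_set (sign_mats n m)"
    unfolding sign_mats_def by (intro Pi_pmf_of_set) auto
  have ne: "sign_mats n m \<noteq> {}" using card_sign_mats[of n m] by (metis card.empty power_eq_0_iff zero_neq_numeral)
  have "measure_pmf.prob (random_sign_matrix n m) {M. \<not> ereal r \<le> ereal_of_enat (Res M)}
     = measure_pmf.prob (pmf_of_set (sign_mats n m)) {X. \<not> ereal r \<le> ereal_of_enat (Res (mat n m X))}"
    unfolding random_sign_matrix_def Pi by (simp add: vimage_def)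
  also have "\<dots> \<le> measure_pmf.prob (pmf_of_set (sign_mats n m)) ?B"
    using Res_less_imp[of n m _ r] by (intro measure_pmf.finite_measure_mono) (auto simp: not_le)
  also have "\<dots> = real (card (sign_mats n m \<inter> ?B)) / 2 ^ (n * m)"
    using ne by (simp add: measure_pmf_of_set card_sign_mats)
  finally show ?thesis by (simp add: Int_def)
qed

subsection \<open>Asymptotics\<close>

text \<open>Collects the largeness conditions on \<open>n\<close> for
  \<open>card_fragile_le_exp\<close>. The exponent \<open>11 \<epsilon> / 60\<close>, the order of
  \<open>ln p\<close>, lies strictly between \<open>\<epsilon> / 6\<close> and
  \<open>\<epsilon> / 5\<close>: the surplus columns win while small supports stay cheap.\<close>

lemma eventually_parameter_conditions:
  fixes \<epsilon> :: real
  assumes \<epsilon>: "0 < \<epsilon>" "\<epsilon> < 1"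
  shows "\<forall>\<^sub>F n in sequentially. 5 * real n powr (11 * \<epsilon> / 60) \<le> real n powr (\<epsilon> / 5)"
    "\<forall>\<^sub>F n in sequentially. 1 \<le> real n powr (11 * \<epsilon> / 60)"
    "\<forall>\<^sub>F n in sequentially. 4 \<le> real n powr (1 / 2 - \<epsilon> / 5)"
    "\<forall>\<^sub>F n in sequentially. 16 * real n powr (1 - \<epsilon> / 5) \<le> real n"
    "\<forall>\<^sub>F n in sequentially. 16 * real n powr (1 - \<epsilon> / 5) * (ln (real n) + 5 * real n powr (11 * \<epsilon> / 60))
        \<le> \<epsilon>\<^sup>2 / 8 * real n"
    "\<forall>\<^sub>F n in sequentially. 4 * (ln (real n) + 4) \<le> real n powr (\<epsilon> / 60)"
    "\<forall>\<^sub>F n in sequentially. 80 * (real n powr (1 - \<epsilon> / 5) * real n powr (11 * \<epsilon> / 60)) \<le> real n"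
    "\<forall>\<^sub>F n in sequentially. 8 \<le> \<epsilon> / 10 * ln (real n)"
    "\<forall>\<^sub>F n in sequentially. 1 \<le> n"
proof -
  have \<epsilon>2: "\<epsilon>\<^sup>2 > 0" using \<epsilon> by simp
  show "\<forall>\<^sub>F n in sequentially. 5 * real n powr (11 * \<epsilon> / 60) \<le> real n powr (\<epsilon> / 5)"
    using \<epsilon> by real_asymp
  show "\<forall>\<^sub>F n in sequentially. 1 \<le> real n powr (11 * \<epsilon> / 60)"
    using \<epsilon> by real_asymp
  show "\<forall>\<^sub>F n in sequentially. 4 \<le> real n powr (1 / 2 - \<epsilon> / 5)"
    using \<epsilon> by real_asymp
  show "\<forall>\<^sub>F n in sequentially. 16 * real n powr (1 - \<epsilon> / 5) \<le> real n"
    using \<epsilon> by real_asymp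
  show "\<forall>\<^sub>F n in sequentially. 16 * real n powr (1 - \<epsilon> / 5) * (ln (real n) + 5 * real n powr (11 * \<epsilon> / 60))
        \<le> \<epsilon>\<^sup>2 / 8 * real n"
    using \<epsilon> \<epsilon>2 by real_asymp
  show "\<forall>\<^sub>F n in sequentially. 4 * (ln (real n) + 4) \<le> real n powr (\<epsilon> / 60)"
    using \<epsilon> by real_asymp
  show "\<forall>\<^sub>F n in sequentially. 80 * (real n powr (1 - \<epsilon> / 5) * real n powr (11 * \<epsilon> / 60)) \<le> real n"
    using \<epsilon> by real_asymp
  show "\<forall>\<^sub>F n in sequentially. 8 \<le> \<epsilon> / 10 * ln (real n)"
    using \<epsilon> by real_asymp
  show "\<forall>\<^sub>F n in sequentially. 1 \<le> n" by (rule eventually_ge_at_top)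
qed

text \<open>As powers of \<open>n\<close>, \<open>k\<close> has exponent
  \<open>\<epsilon> / 5\<close>, \<open>L\<close> has \<open>1 / 2 - \<epsilon> / 5\<close> and
  \<open>ln p\<close> has \<open>11 \<epsilon> / 60\<close>, so \<open>s\<close> has
  \<open>1 - \<epsilon> / 5\<close>. The three terms of \<open>card_fragile_le\<close> are bounded
  separately.\<close>

lemma card_fragile_le_exp:
  fixes \<epsilon> :: real and n m :: nat
  defines "x \<equiv> real n" and "\<kappa> \<equiv> (1 - \<epsilon>) * (real m / 2)"
  assumes \<epsilon>: "0 < \<epsilon>" "\<epsilon> < 1" and m: "x + x powr (1 - \<epsilon> / 6) \<le> real m"
    and c1: "5 * x powr (11 * \<epsilon> / 60) \<le> x powr (\<epsilon> / 5)"
    and c2: "1 \<le> x powr (11 * \<epsilon> / 60)"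
    and c3: "4 \<le> x powr (1 / 2 - \<epsilon> / 5)"
    and c4: "16 * x powr (1 - \<epsilon> / 5) \<le> x"
    and c5: "16 * x powr (1 - \<epsilon> / 5) * (ln x + 5 * x powr (11 * \<epsilon> / 60)) \<le> \<epsilon>\<^sup>2 / 8 * x"
    and c6: "4 * (ln x + 4) \<le> x powr (\<epsilon> / 60)"
    and c7: "80 * (x powr (1 - \<epsilon> / 5) * x powr (11 * \<epsilon> / 60)) \<le> x"
    and c8: "8 \<le> \<epsilon> / 10 * ln x"
    and n1: "1 \<le> n"
  shows "real (card {X \<in> sign_mats n m. \<exists>S \<subseteq> {..<n} \<times> {..<m}. real (card S) < \<kappa> \<and>
            vec_space.rank n (flip_entries S (mat n m X)) < n}) / 2 ^ (n * m)
    \<le> exp (- (\<epsilon>\<^sup>2 / 8) * x) + 2 * exp (- x)"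
proof -
  have x: "x \<ge> 1" "x > 0" using n1 by (auto simp: x_def)
  have lnx: "ln x \<ge> 0" using x by simp
  have mn: "x \<le> real m" using m by (smt (verit) powr_ge_zero)
  define k where "k = nat \<lceil>x powr (\<epsilon> / 5)\<rceil>"
  define L where "L = nat \<lfloor>x powr (1 / 2 - \<epsilon> / 5)\<rfloor>"
  define t where "t = nat \<lceil>x powr (11 * \<epsilon> / 60)\<rceil>"
  have xb: "1 \<le> x powr (\<epsilon> / 5)" using c1 c2 by linarith
  have k: "x powr (\<epsilon> / 5) \<le> real k" "real k \<le> 2 * x powr (\<epsilon> / 5)" "k \<ge> 1"
    using xb unfolding k_def by linarith+
  have L: "x powr (1 / 2 - \<epsilon> / 5) / 2 \<le> real L" "real L \<le> x powr (1 / 2 - \<epsilon> / 5)" "L \<ge> 2"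
    using c3 unfolding L_def by linarith+
  have t: "x powr (11 * \<epsilon> / 60) \<le> real t" "real t \<le> x powr (11 * \<epsilon> / 60) + 1" "t \<ge> 1"
    using c2 unfolding t_def by linarith+
  obtain p :: nat where p: "prime p" "2 ^ t < p" "p \<le> 2 ^ (2 * t + 1)"
    using prime_between_powers_of_two[OF t(3)] by blast
  have p0: "real p > 0" using p prime_gt_0_nat by simp
  have "(2::nat) ^ 1 \<le> 2 ^ t" using t(3) by (intro power_increasing) auto
  then have "p > 2" using p(2) by simp
  then have p_odd: "odd p" using p(1) prime_odd_nat by simp
  define l where "l = ln (real p)"
  have pl: "real p = exp l" using p0 by (simp add: l_def)
  have ln2: "1 / 2 \<le> ln (2::real)" "ln (2::real) \<le> 1" using ln2_ge_two_thirds ln_2_less_1 by linarith+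
  have l1: "x powr (11 * \<epsilon> / 60) / 2 \<le> l"
  proof -
    have "real t * ln 2 = ln (2 ^ t)" by (simp add: ln_realpow)
    also have "\<dots> \<le> l"
    proof -
      have "real (2 ^ t) \<le> real p" using p(2) by (intro of_nat_mono) simp
      then show ?thesis using p0 by (simp add: l_def)
    qed
    finally have "real t * ln 2 \<le> l" .
    moreover have "real t * (1 / 2) \<le> real t * ln 2" using ln2 by (intro mult_left_mono) auto
    ultimately show ?thesis using t(1) by linarith
  qed
  have l2: "l \<le> 5 * x powr (11 * \<epsilon> / 60)"
  proof -
    have "real p \<le> real (2 ^ (2 * t + 1))" using p(3) by (rule of_nat_mono)
    then have "l \<le> ln (2 ^ (2 * t + 1))" using p0 by (simp add: l_def)
    also have "\<dots> = real (2 * t + 1) * ln 2" by (simp only: ln_realpow)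
    also have "\<dots> \<le> real (2 * t + 1) * 1" using ln2 by (intro mult_left_mono) auto
    finally show ?thesis using t(2) c2 by simp
  qed
  have l0: "l \<ge> 0" using l1 c2 by linarith
  have pk: "real p \<le> exp (real k)" unfolding pl using l2 c1 k(1) by simp
  define s where "s = 8 * k * L\<^sup>2"
  have s: "real s \<le> 16 * x powr (1 - \<epsilon> / 5)"
  proof -
    have "real s = 8 * real k * (real L)\<^sup>2" by (simp add: s_def)
    also have "\<dots> \<le> 8 * (2 * x powr (\<epsilon> / 5)) * (x powr (1 / 2 - \<epsilon> / 5))\<^sup>2"
      using k L by (intro mult_mono power_mono) auto
    also have "\<dots> = 16 * (x powr (\<epsilon> / 5) * (x powr (1 / 2 - \<epsilon> / 5) * x powr (1 / 2 - \<epsilon> / 5)))"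
      by (simp add: power2_eq_square)
    also have "\<dots> = 16 * x powr (1 - \<epsilon> / 5)"
      by (simp only: powr_add[symmetric]) simp
    finally show ?thesis .
  qed
  then have sn: "s \<le> n" using c4 by (simp add: x_def)
  have kappa: "x powr \<kappa> = exp (\<kappa> * ln x)" using x by (simp add: powr_def)
  have \<kappa>m: "\<kappa> * ln x \<le> real m * ln x"
  proof (intro mult_right_mono lnx)
    have "(1 - \<epsilon>) * (real m / 2) \<le> 1 * (real m / 2)" using \<epsilon> by (intro mult_right_mono) auto
    then show "\<kappa> \<le> real m" unfolding \<kappa>_def by linarith
  qed
  have ln4: "ln (4::real) \<le> 2"
  proof -
    have "ln (4::real) = ln (2 ^ 2)" by simp
    also have "\<dots> = 2 * ln 2" by (subst ln_realpow) auto
    finally show ?thesis using ln2 by simp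
  qed
  \<comment> \<open>Enumerating small supports costs \<open>s * ln p\<close> of order
    \<open>n powr (1 - \<epsilon> / 60)\<close> and a smaller \<open>s * ln n\<close>, in total at
    most half of the Chernoff exponent.\<close>
  have T1: "(real n * real p) ^ s * exp (- (\<epsilon>\<^sup>2 / 4) * m) \<le> exp (- (\<epsilon>\<^sup>2 / 8) * x)"
  proof -
    have "real n * real p = exp (ln x + l)" using x by (simp add: exp_add pl x_def)
    then have "(real n * real p) ^ s * exp (- (\<epsilon>\<^sup>2 / 4) * m) = exp (real s * (ln x + l) - \<epsilon>\<^sup>2 / 4 * m)"
      by (simp add: exp_of_nat_mult[symmetric] exp_add[symmetric])
    also have "real s * (ln x + l) \<le> 16 * x powr (1 - \<epsilon> / 5) * (ln x + 5 * x powr (11 * \<epsilon> / 60))"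
      using s l2 lnx l0 by (intro mult_mono add_mono) auto
    also note c5
    also have "\<epsilon>\<^sup>2 / 8 * x - \<epsilon>\<^sup>2 / 4 * m \<le> \<epsilon>\<^sup>2 / 8 * x - \<epsilon>\<^sup>2 / 4 * x"
      using mn by (intro diff_left_mono mult_left_mono) auto
    also have "\<dots> = - (\<epsilon>\<^sup>2 / 8) * x" by simp
    finally show ?thesis by simp
  qed
  \<comment> \<open>The surplus gain \<open>(m - n) * ln p\<close> has to beat the flip sets and
    constants, about \<open>m * ln n\<close>.\<close>
  have T2: "real n powr \<kappa> * exp m * (real p ^ n * (4 / real p) ^ m) \<le> exp (- x)"
  proof -
    have "4 / real p = exp (ln 4 - l)" by (simp add: exp_diff pl)
    then have "real n powr \<kappa> * exp m * (real p ^ n * (4 / real p) ^ m)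
       = exp (\<kappa> * ln x + real m + (real n * l + real m * (ln 4 - l)))"
      unfolding x_def[symmetric] kappa pl by (simp add: exp_of_nat_mult[symmetric] exp_add x_def)
    moreover have "\<kappa> * ln x + real m + (real n * l + real m * (ln 4 - l))
      \<le> real m * ln x + 3 * real m - (real m - x) * l"
      using \<kappa>m mult_left_mono[OF ln4, of "real m"] by (simp add: algebra_simps x_def)
    moreover have "real m * (ln x + 4) \<le> (real m - x) * l"
    proof -
      define y where "y = x powr (- (\<epsilon> / 6))"
      have y: "0 \<le> y" "y \<le> 1" using x \<epsilon> powr_mono[of "- (\<epsilon> / 6)" 0 x] by (auto simp: y_def)
      have "x powr (1 - \<epsilon> / 6) = x * y" using x powr_add[of x 1 "- (\<epsilon> / 6)"] by (simp add: y_def)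
      then have "x * (1 + y) \<le> real m" using m by (simp add: algebra_simps)
      \<comment> \<open>The relative surplus \<open>(m - n) / m\<close> is at least
        \<open>y / 2\<close> for every admissible \<open>m\<close>, because
        \<open>(1 + y) * (2 - y) \<ge> 2\<close> on \<open>[0, 1]\<close>.\<close>
      then have "real m * y / 2 \<le> real m - x"
      proof -
        assume a: "x * (1 + y) \<le> real m"
        have "x * (2 + 0) \<le> real m * (2 - y)"
        proof -
          have "x * 2 \<le> x * ((1 + y) * (2 - y))"
          proof (intro mult_left_mono)
            have "0 \<le> y * (1 - y)" using y by simp
            then show "2 \<le> (1 + y) * (2 - y)" by (simp add: algebra_simps)
          qed (use x in auto)
          also have "\<dots> \<le> real m * (2 - y)"
            using mult_right_mono[OF a, of "2 - y"] y by (simp add: mult.assoc)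
          finally show ?thesis by simp
        qed
        then show ?thesis by (simp add: algebra_simps)
      qed
      then have "real m * y / 2 * (x powr (11 * \<epsilon> / 60) / 2) \<le> (real m - x) * l"
        using l1 mn y by (intro mult_mono) auto
      \<comment> \<open>The remaining exponent
        \<open>11 \<epsilon> / 60 - \<epsilon> / 6 = \<epsilon> / 60\<close> is positive, so by
        \<open>c6\<close> it beats the logarithm.\<close>
      moreover have "x powr (\<epsilon> / 60) = y * x powr (11 * \<epsilon> / 60)"
        unfolding y_def by (simp add: powr_add[symmetric])
      ultimately have "real m / 4 * x powr (\<epsilon> / 60) \<le> (real m - x) * l" by (simp add: mult_ac)
      moreover have "real m / 4 * (4 * (ln x + 4)) \<le> real m / 4 * x powr (\<epsilon> / 60)"
        using c6 by (intro mult_left_mono) auto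
      moreover have "real m / 4 * (4 * (ln x + 4)) = real m * (ln x + 4)" by simp
      ultimately show ?thesis by linarith
    qed
    moreover have "real m * (ln x + 4) = real m * ln x + 4 * real m" by (simp add: distrib_left)
    ultimately show ?thesis using mn by simp
  qed
  have T3: "real n powr \<kappa> * exp m * ((4 / real L) ^ m * (2 * real k) ^ n * real p ^ s) \<le> exp (- x)"
  proof -
    have k0: "real k > 0" and L0: "real L > 0" using k L by auto
    have "(4 / real L) ^ m = exp (real m * (ln 4 - ln (real L)))"
      using L0 by (simp add: exp_of_nat_mult exp_diff)
    moreover have "(2 * real k) ^ n = exp (real n * ln (2 * real k))"
      using k0 by (simp add: exp_of_nat_mult)
    moreover have "real p ^ s = exp (real s * l)" by (simp add: exp_of_nat_mult pl)
    moreover have "real n powr \<kappa> = exp (\<kappa> * ln x)" using kappa by (simp add: x_def)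
    ultimately have "real n powr \<kappa> * exp m * ((4 / real L) ^ m * (2 * real k) ^ n * real p ^ s)
       = exp (\<kappa> * ln x + real m + (real m * (ln 4 - ln (real L)) + real n * ln (2 * real k) + real s * l))"
      by (simp only: exp_add)
    also have "\<kappa> * ln x + real m + (real m * (ln 4 - ln (real L)) + real n * ln (2 * real k) + real s * l)
       \<le> \<kappa> * ln x + real m + (real m * (3 - (1 / 2 - \<epsilon> / 5) * ln x) + real m * (2 + \<epsilon> / 5 * ln x) + real m)"
    proof (intro add_mono order_refl mult_left_mono)
      have "ln (x powr (1 / 2 - \<epsilon> / 5) / 2) \<le> ln (real L)" using L x L0 by (subst ln_le_cancel_iff) auto
      then have "(1 / 2 - \<epsilon> / 5) * ln x - ln 2 \<le> ln (real L)" using x by (simp add: ln_div ln_powr)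
      then show "ln 4 - ln (real L) \<le> 3 - (1 / 2 - \<epsilon> / 5) * ln x" using ln4 ln2 by linarith
      have "ln (2 * real k) \<le> ln (4 * x powr (\<epsilon> / 5))" using k k0 x by (subst ln_le_cancel_iff) auto
      also have "\<dots> = ln 4 + \<epsilon> / 5 * ln x" using x by (simp add: ln_mult ln_powr)
      finally have lk: "ln (2 * real k) \<le> 2 + \<epsilon> / 5 * ln x" using ln4 by linarith
      have "0 \<le> ln (2 * real k)" using k by simp
      then show "real n * ln (2 * real k) \<le> real m * (2 + \<epsilon> / 5 * ln x)"
        using lk mn by (intro mult_mono) (auto simp: x_def)
      have "real s * l \<le> 16 * x powr (1 - \<epsilon> / 5) * (5 * x powr (11 * \<epsilon> / 60))"
        using s l2 l0 by (intro mult_mono) auto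
      then show "real s * l \<le> real m" using c7 mn by simp
    qed simp
    \<comment> \<open>Exponents of \<open>n\<close> per column: \<open>(1 - \<epsilon>) / 2\<close>
      from the flips, \<open>- (1 / 2 - \<epsilon> / 5)\<close> from \<open>L\<close> and
      \<open>\<epsilon> / 5\<close> from \<open>k\<close>, in total
      \<open>- \<epsilon> / 10\<close>.\<close>
    also have "\<dots> = real m * (7 - \<epsilon> / 10 * ln x)"
      by (simp add: \<kappa>_def field_simps)
    also have "\<dots> \<le> real m * (- 1)" using c8 by (intro mult_left_mono) auto
    finally have "real n powr \<kappa> * exp m * ((4 / real L) ^ m * (2 * real k) ^ n * real p ^ s) \<le> exp (real m * (- 1))"
      by simp
    also have "\<dots> \<le> exp (- x)" using mn by simp
    finally show ?thesis .
  qed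
  have "real (card {X \<in> sign_mats n m. \<exists>S \<subseteq> {..<n} \<times> {..<m}. real (card S) < \<kappa> \<and>
            vec_space.rank n (flip_entries S (mat n m X)) < n}) / 2 ^ (n * m)
    \<le> (real n * real p) ^ s * exp (- (\<epsilon>\<^sup>2 / 4) * m)
       + real n powr \<kappa> * exp m * (real p ^ n * (4 / real p) ^ m + (4 / real L) ^ m * (2 * real k) ^ n * real p ^ s)"
    using card_fragile_le[OF p(1) p_odd pk L(3) s_def sn k(3) n1 _ \<epsilon>(1), of m] mn
    unfolding \<kappa>_def by (simp add: x_def pos_divide_le_eq mult.commute)
  also have "\<dots> \<le> exp (- (\<epsilon>\<^sup>2 / 8) * x) + 2 * exp (- x)"
    using T1 T2 T3 by (simp add: distrib_left)
  finally show ?thesis .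
qed

theorem theorem1p1:
  fixes \<epsilon> :: real and m :: "nat \<Rightarrow> nat"
  assumes "\<epsilon> > 0"
    and "\<And>n. n \<ge> 1 \<Longrightarrow> real (m n) \<ge> real n + real n powr (1 - \<epsilon> / 6)"
  shows "(\<lambda>n. measure_pmf.prob (random_sign_matrix n (m n))
            {M. ereal_of_enat (Res M) \<ge> ereal ((1 - \<epsilon>) * (real (m n) / 2))})
         \<longlonglongrightarrow> 1"
proof (cases "\<epsilon> < 1")
  \<comment> \<open>For \<open>\<epsilon> \<ge> 1\<close> the claimed bound is at most zero and
    holds for every matrix.\<close>
  case False
  have "ereal ((1 - \<epsilon>) * (real (m n) / 2)) \<le> ereal_of_enat (Res M)" for n M
  proof -
    have "ereal ((1 - \<epsilon>) * (real (m n) / 2)) \<le> 0" using False by (simp add: mult_nonpos_nonneg)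
    also have "0 \<le> ereal_of_enat (Res M)" by simp
    finally show ?thesis .
  qed
  then show ?thesis by simp
next
  case True
  let ?P = "\<lambda>n. measure_pmf.prob (random_sign_matrix n (m n))
    {M. ereal_of_enat (Res M) \<ge> ereal ((1 - \<epsilon>) * (real (m n) / 2))}"
  let ?f = "\<lambda>n. exp (- (\<epsilon>\<^sup>2 / 8) * real n) + 2 * exp (- real n)"
  have "\<forall>\<^sub>F n in sequentially. 1 - ?f n \<le> ?P n"
    using eventually_parameter_conditions[OF assms(1) True]
  proof eventually_elim
    case (elim n)
    have "1 - ?P n = measure_pmf.prob (random_sign_matrix n (m n))
       {M. \<not> ereal ((1 - \<epsilon>) * (real (m n) / 2)) \<le> ereal_of_enat (Res M)}"
      by (subst measure_pmf.prob_compl[symmetric]) (auto simp: Collect_neg_eq Compl_eq_Diff_UNIV)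
    also have "\<dots> \<le> ?f n"
      using prob_Res_less_le card_fragile_le_exp[OF assms(1) True assms(2)[OF elim(9)] elim]
      by (rule order_trans)
    finally show ?case by linarith
  qed
  moreover have "(\<lambda>n. 1 - ?f n) \<longlonglongrightarrow> 1"
  proof -
    have exp0: "(\<lambda>n. exp (- c * real n)) \<longlonglongrightarrow> 0" if "c > 0" for c :: real
    proof -
      have "(\<lambda>n. exp (- c) ^ n) \<longlonglongrightarrow> 0" using that by (intro LIMSEQ_realpow_zero) auto
      then show ?thesis by (simp add: exp_of_nat2_mult[symmetric])
    qed
    have "(\<lambda>n. 1 - (exp (- (\<epsilon>\<^sup>2 / 8) * real n) + 2 * exp (- 1 * real n))) \<longlonglongrightarrow> 1 - (0 + 2 * 0)"
      using assms(1) by (intro tendsto_intros exp0) auto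
    then show ?thesis by simp
  qed
  ultimately show ?thesis
    by (intro tendsto_sandwich[of "\<lambda>n. 1 - ?f n" ?P _ "\<lambda>_. 1"]) auto
qed

end
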